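(* Let $n,m\ge1$ be integers, $\mathbf P=B_{n,m}$ the bipath poset, $\zeta'\colon Z'\to\mathbf P$ the order-preserving map defined in the context, and $R'\colon\operatorname{mod}\Bbbk[\mathbf P]\to\operatorname{mod}\Bbbk[Z']$, $M\mapsto M\circ\Bbbk[\zeta']$, the restriction functor induced by $\zeta'$. Then for every interval $I\in\mathbb I_{\mathrm d}\sqcup\mathbb I_{\mathrm u}\sqcup\mathbb I_{l}\sqcup\{B_{n,m}\}$ and every $M\in\operatorname{mod}\Bbbk[\mathbf P]$, $$d_M(V_I)=\bar d_{R'(M)}(R'(V_I))=d_{R'(M)}(R'(V_I)).$$
   Context: $\Bbbk$ is a field. For a finite poset $S$, $\Bbbk[S]$ is the $\Bbbk$-linearization of $S$ viewed as a category and $\operatorname{mod}\Bbbk[S]$ is the category of $\Bbbk$-linear functors from $\Bbbk[S]$ to finite-dimensional vector spaces. For an interval $I$ (nonempty connected convex full subposet), $V_I$ is the module with $V_I(x)=\Bbbk$ for $x\in I$, $0$ otherwise, identity structure maps inside $I$, zero otherwise. For an indecomposable module $L$, $d_N(L)$ is its multiplicity in a decomposition of $N$ into indecomposables; for a general module $L$, if $N\cong L^r\oplus N'$ with $N'$ having no direct summand isomorphic to $L$, then $\bar d_N(L):=r$. The bipath poset $B_{n,m}$ has elements $\hat0,\hat1,1,\dots,n,1',\dots,m'$ and order generated by $\hat0<1<2<\cdots<n<\hat1$ and $\hat0<1'<2'<\cdots<m'<\hat1$. $\mathbb I_{\mathrm u}$ is the set of intervals $[s,t]=\{x\mid s\le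 x\le t\}$ with $s\le t$ in $\{1,\dots,n\}$; $\mathbb I_{\mathrm d}$ is the set of intervals $[s',t']$ with $s'\le t'$ in $\{1',\dots,m'\}$; $\mathbb I_{l}$ is the set of intervals $[\hat0,t]\cup[\hat0,t']$ with $t\in\{\hat0,1,\dots,n\}$ and $t'\in\{\hat0,1',\dots,m'\}$. $Z'$ is the poset with elements $\hat0,\hat1,\bar1,1,\dots,n,1',\dots,m'$ and order generated by $\hat0<1<2<\cdots<n<\hat1$ and $\hat0<1'<2'<\cdots<m'<\bar1$ (so $\hat1$ and $\bar1$ are incomparable). $\zeta'\colon Z'\to B_{n,m}$ is given by $\zeta'(x)=x$ for $x\in Z'\setminus\{\bar1\}$ and $\zeta'(\bar1)=\hat1$; $\Bbbk[\zeta']$ is the induced linear functor. *)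

theory Defs
  imports "HOL-Analysis.Product_Vector" "HOL-Library.Function_Algebras"
begin

section \<open>Modules over the linearization of a poset\<close>

text \<open>
  A poset is a partial order relation \<open>P\<close>, with underlying set \<open>Field P\<close>. In its
  linearization, the morphisms \<open>x \<rightarrow> y\<close> are the multiples \<open>c \<cdot> (x \<le> y)\<close> if \<open>x \<le> y\<close>, and only
  \<open>0\<close> otherwise; a morphism is represented by its coefficient \<open>c\<close>, and composition
  multiplies coefficients.
\<close>

definition lin_hom :: "'x rel \<Rightarrow> 'x \<Rightarrow> 'x \<Rightarrow> 'k::field set" where
  "lin_hom P x y = (if (x, y) \<in> P then UNIV else {0})"

text \<open>
  A functor \<open>M\<close> to finite-dimensional vector spaces is given by the spaces \<open>space_at M x\<close> and
  the maps \<open>action M x y c\<close>, the image of the morphism \<open>x \<rightarrow> y\<close> with coefficient \<open>c\<close>. The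
  spaces of one module are subspaces of an ambient vector space, whose elements are all
  elements of the type \<open>'v\<close>, with scalar multiplication \<open>scalar M\<close>. Up to isomorphism this is
  no restriction, since the values of a functor embed into their direct sum. No finiteness or
  other condition is put on the ambient space, and isomorphisms may relate modules with
  different ambient spaces.
\<close>

record ('k, 'x, 'v) pmodule =
  scalar :: "'k \<Rightarrow> 'v \<Rightarrow> 'v"
  space_at :: "'x \<Rightarrow> 'v set"
  action :: "'x \<Rightarrow> 'x \<Rightarrow> 'k \<Rightarrow> 'v \<Rightarrow> 'v"

definition linear_between ::
  "('k \<Rightarrow> 'v \<Rightarrow> 'v) \<Rightarrow> 'v::ab_group_add set \<Rightarrow> ('k \<Rightarrow> 'w \<Rightarrow> 'w) \<Rightarrow> 'w::ab_group_add set
    \<Rightarrow> ('v \<Rightarrow> 'w) \<Rightarrow> bool" where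
  "linear_between s V t W f \<longleftrightarrow>
     (\<forall>v\<in>V. f v \<in> W) \<and>
     (\<forall>u\<in>V. \<forall>v\<in>V. f (u + v) = f u + f v) \<and>
     (\<forall>a. \<forall>v\<in>V. f (s a v) = t a (f v))"

definition is_pmodule :: "'x rel \<Rightarrow> ('k::field, 'x, 'v::ab_group_add) pmodule \<Rightarrow> bool" where
  "is_pmodule P M \<longleftrightarrow>
     vector_space (scalar M) \<and>
     (\<forall>x\<in>Field P. \<exists>B. finite B \<and> space_at M x = module.span (scalar M) B) \<and>
     (\<forall>x\<in>Field P. \<forall>y\<in>Field P. \<forall>c\<in>lin_hom P x y.
        linear_between (scalar M) (space_at M x) (scalar M) (space_at M y) (action M x y c)) \<and>
     (\<forall>x\<in>Field P. \<forall>y\<in>Field P. \<forall>c\<in>lin_hom P x y. \<forall>d\<in>lin_hom P x y. \<forall>v\<in>space_at M x.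
        action M x y (c + d) v = action M x y c v + action M x y d v) \<and>
     (\<forall>x\<in>Field P. \<forall>y\<in>Field P. \<forall>c\<in>lin_hom P x y. \<forall>a. \<forall>v\<in>space_at M x.
        action M x y (a * c) v = scalar M a (action M x y c v)) \<and>
     (\<forall>x\<in>Field P. \<forall>v\<in>space_at M x. action M x x 1 v = v) \<and>
     (\<forall>x\<in>Field P. \<forall>y\<in>Field P. \<forall>z\<in>Field P. \<forall>c\<in>lin_hom P x y. \<forall>d\<in>lin_hom P y z.
        \<forall>v\<in>space_at M x. action M x z (d * c) v = action M y z d (action M x y c v))"

definition pmodule_hom ::
  "'x rel \<Rightarrow> ('k::field, 'x, 'v::ab_group_add) pmodule \<Rightarrow> ('k, 'x, 'w::ab_group_add) pmodule
    \<Rightarrow> ('x \<Rightarrow> 'v \<Rightarrow> 'w) \<Rightarrow> bool" where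
  "pmodule_hom P M N f \<longleftrightarrow>
     (\<forall>x\<in>Field P. linear_between (scalar M) (space_at M x) (scalar N) (space_at N x) (f x)) \<and>
     (\<forall>x\<in>Field P. \<forall>y\<in>Field P. \<forall>c\<in>lin_hom P x y. \<forall>v\<in>space_at M x.
        f y (action M x y c v) = action N x y c (f x v))"

definition pmodule_iso ::
  "'x rel \<Rightarrow> ('k::field, 'x, 'v::ab_group_add) pmodule \<Rightarrow> ('k, 'x, 'w::ab_group_add) pmodule
    \<Rightarrow> bool" where
  "pmodule_iso P M N \<longleftrightarrow>
     (\<exists>f. pmodule_hom P M N f \<and> (\<forall>x\<in>Field P. bij_betw (f x) (space_at M x) (space_at N x)))"

definition is_zero :: "'x rel \<Rightarrow> ('k, 'x, 'v::zero) pmodule \<Rightarrow> bool" where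
  "is_zero P M \<longleftrightarrow> (\<forall>x\<in>Field P. space_at M x = {0})"

definition direct_sum ::
  "('k::field, 'x, 'v::ab_group_add) pmodule \<Rightarrow> ('k, 'x, 'w::ab_group_add) pmodule
    \<Rightarrow> ('k, 'x, 'v \<times> 'w) pmodule" where
  "direct_sum M N =
     \<lparr>scalar = module_prod.scale (scalar M) (scalar N),
      space_at = (\<lambda>x. space_at M x \<times> space_at N x),
      action = (\<lambda>x y c. map_prod (action M x y c) (action N x y c))\<rparr>"

text \<open>
  The direct sum of \<open>F 0, \<dots>, F (r - 1)\<close>. The modules \<open>F i\<close> with \<open>i \<ge> r\<close> contribute only their
  scalar multiplication, which makes the functions \<open>nat \<Rightarrow> 'v\<close> an ambient vector space.
\<close>

definition finite_direct_sum ::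
  "nat \<Rightarrow> (nat \<Rightarrow> ('k::field, 'x, 'v::ab_group_add) pmodule) \<Rightarrow> ('k, 'x, nat \<Rightarrow> 'v) pmodule" where
  "finite_direct_sum r F =
     \<lparr>scalar = (\<lambda>a f i. scalar (F i) a (f i)),
      space_at = (\<lambda>x. {f. (\<forall>i<r. f i \<in> space_at (F i) x) \<and> (\<forall>i\<ge>r. f i = 0)}),
      action = (\<lambda>x y c f i. if i < r then action (F i) x y c (f i) else 0)\<rparr>"

definition power_sum ::
  "('k::field, 'x, 'v::ab_group_add) pmodule \<Rightarrow> nat \<Rightarrow> ('k, 'x, nat \<Rightarrow> 'v) pmodule" where
  "power_sum L r = finite_direct_sum r (\<lambda>_. L)"


section \<open>Multiplicities\<close>

text \<open>
  A direct summand of a module is isomorphic to a submodule of it. Hence it suffices, below, to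
  let summands range over the modules with the same ambient type as the whole module.
\<close>

definition indecomposable :: "'x rel \<Rightarrow> ('k::field, 'x, 'v::ab_group_add) pmodule \<Rightarrow> bool" where
  "indecomposable P L \<longleftrightarrow>
     is_pmodule P L \<and> \<not> is_zero P L \<and>
     (\<forall>(A :: ('k, 'x, 'v) pmodule) (B :: ('k, 'x, 'v) pmodule).
        is_pmodule P A \<longrightarrow> is_pmodule P B \<longrightarrow> pmodule_iso P L (direct_sum A B) \<longrightarrow>
        is_zero P A \<or> is_zero P B)"

definition has_summand ::
  "'x rel \<Rightarrow> ('k::field, 'x, 'v::ab_group_add) pmodule \<Rightarrow> ('k, 'x, 'w::ab_group_add) pmodule
    \<Rightarrow> bool" where
  "has_summand P N L \<longleftrightarrow>
     (\<exists>N' :: ('k, 'x, 'v) pmodule. is_pmodule P N' \<and> pmodule_iso P N (direct_sum L N'))"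

definition indec_decomposition ::
  "'x rel \<Rightarrow> ('k::field, 'x, 'v::ab_group_add) pmodule \<Rightarrow> nat
    \<Rightarrow> (nat \<Rightarrow> ('k, 'x, 'v) pmodule) \<Rightarrow> bool" where
  "indec_decomposition P N l F \<longleftrightarrow>
     (\<forall>i. is_pmodule P (F i)) \<and> (\<forall>i<l. indecomposable P (F i)) \<and>
     pmodule_iso P N (finite_direct_sum l F)"

text \<open>The multiplicity \<open>d_N(L)\<close>, meant for indecomposable \<open>L\<close>.\<close>

definition mult ::
  "'x rel \<Rightarrow> ('k::field, 'x, 'v::ab_group_add) pmodule \<Rightarrow> ('k, 'x, 'w::ab_group_add) pmodule
    \<Rightarrow> nat" where
  "mult P N L =
     (THE k. \<exists>l F. indec_decomposition P N l F \<and> k = card {i. i < l \<and> pmodule_iso P (F i) L})"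

text \<open>The multiplicity written as \<open>d_N(L)\<close> with a bar, for arbitrary \<open>L\<close>.\<close>

definition mult_bar ::
  "'x rel \<Rightarrow> ('k::field, 'x, 'v::ab_group_add) pmodule \<Rightarrow> ('k, 'x, 'w::ab_group_add) pmodule
    \<Rightarrow> nat" where
  "mult_bar P N L =
     (THE r. \<exists>N' :: ('k, 'x, 'v) pmodule.
        is_pmodule P N' \<and> pmodule_iso P N (direct_sum (power_sum L r) N') \<and> \<not> has_summand P N' L)"


section \<open>Interval modules and restriction\<close>

definition interval_module :: "'x set \<Rightarrow> ('k::field, 'x, 'k) pmodule" where
  "interval_module I =
     \<lparr>scalar = (*),
      space_at = (\<lambda>x. if x \<in> I then UNIV else {0}),
      action = (\<lambda>x y c v. if x \<in> I \<and> y \<in> I then c * v else 0)\<rparr>"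

text \<open>
  Precomposition with the linear functor induced by an order-preserving map \<open>h\<close>, which sends
  \<open>c \<cdot> (x \<le> y)\<close> to \<open>c \<cdot> (h x \<le> h y)\<close>.
\<close>

definition restriction :: "('z \<Rightarrow> 'x) \<Rightarrow> ('k, 'x, 'v) pmodule \<Rightarrow> ('k, 'z, 'v) pmodule" where
  "restriction h M =
     \<lparr>scalar = scalar M,
      space_at = (\<lambda>z. space_at M (h z)),
      action = (\<lambda>z w. action M (h z) (h w))\<rparr>"


section \<open>The bipath poset\<close>

text \<open>\<open>Bot\<close>, \<open>Top\<close>, \<open>Up i\<close>, \<open>Dn i\<close> stand for \<open>\<hat>0\<close>, \<open>\<hat>1\<close>, \<open>i\<close>, \<open>i'\<close>.\<close>

datatype bipath_elem = Bot | Top | Up nat | Dn nat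

definition bipath_set :: "nat \<Rightarrow> nat \<Rightarrow> bipath_elem set" where
  "bipath_set n m = {Bot, Top} \<union> Up ` {1..n} \<union> Dn ` {1..m}"

definition bipath_gen :: "nat \<Rightarrow> nat \<Rightarrow> bipath_elem rel" where
  "bipath_gen n m =
     {(Bot, Up 1), (Up n, Top)} \<union> {(Up i, Up (i + 1)) |i. 1 \<le> i \<and> i < n} \<union>
     {(Bot, Dn 1), (Dn m, Top)} \<union> {(Dn i, Dn (i + 1)) |i. 1 \<le> i \<and> i < m}"

definition bipath :: "nat \<Rightarrow> nat \<Rightarrow> bipath_elem rel" where
  "bipath n m = (bipath_gen n m)\<^sup>* \<inter> bipath_set n m \<times> bipath_set n m"

definition segment :: "'x rel \<Rightarrow> 'x \<Rightarrow> 'x \<Rightarrow> 'x set" where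
  "segment P s t = {x. (s, x) \<in> P \<and> (x, t) \<in> P}"

definition intervals_up :: "nat \<Rightarrow> nat \<Rightarrow> bipath_elem set set" where
  "intervals_up n m = {segment (bipath n m) (Up s) (Up t) |s t. 1 \<le> s \<and> s \<le> t \<and> t \<le> n}"

definition intervals_down :: "nat \<Rightarrow> nat \<Rightarrow> bipath_elem set set" where
  "intervals_down n m = {segment (bipath n m) (Dn s) (Dn t) |s t. 1 \<le> s \<and> s \<le> t \<and> t \<le> m}"

definition intervals_left :: "nat \<Rightarrow> nat \<Rightarrow> bipath_elem set set" where
  "intervals_left n m =
     {segment (bipath n m) Bot t \<union> segment (bipath n m) Bot t' |t t'.
        t \<in> {Bot} \<union> Up ` {1..n} \<and> t' \<in> {Bot} \<union> Dn ` {1..m}}"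


section \<open>The poset covering the bipath poset\<close>

text \<open>\<open>Pt x\<close> is the element \<open>x\<close> of the bipath poset, regarded as an element of \<open>Z'\<close>; \<open>Bar1\<close> is the
  additional element.\<close>

datatype zprime_elem = Pt bipath_elem | Bar1

definition zprime_set :: "nat \<Rightarrow> nat \<Rightarrow> zprime_elem set" where
  "zprime_set n m = insert Bar1 (Pt ` bipath_set n m)"

definition zprime_gen :: "nat \<Rightarrow> nat \<Rightarrow> zprime_elem rel" where
  "zprime_gen n m =
     {(Pt Bot, Pt (Up 1)), (Pt (Up n), Pt Top)} \<union>
     {(Pt (Up i), Pt (Up (i + 1))) |i. 1 \<le> i \<and> i < n} \<union>
     {(Pt Bot, Pt (Dn 1)), (Pt (Dn m), Bar1)} \<union>
     {(Pt (Dn i), Pt (Dn (i + 1))) |i. 1 \<le> i \<and> i < m}"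

definition zprime :: "nat \<Rightarrow> nat \<Rightarrow> zprime_elem rel" where
  "zprime n m = (zprime_gen n m)\<^sup>* \<inter> zprime_set n m \<times> zprime_set n m"

fun zeta :: "zprime_elem \<Rightarrow> bipath_elem" where
  "zeta (Pt x) = x"
| "zeta Bar1 = Top"

lemma Field_bipath: "Field (bipath n m) = bipath_set n m"
  by (auto simp: bipath_def Field_def)

lemma Field_zprime: "Field (zprime n m) = zprime_set n m"
  by (auto simp: zprime_def Field_def)

lemma partial_order_on_restricted_rtrancl:
  fixes rank :: "'a \<Rightarrow> nat"
  assumes "\<And>x y. (x, y) \<in> r \<Longrightarrow> rank x < rank y"
  shows "partial_order_on A (r\<^sup>* \<inter> A \<times> A)"
proof -
  have rank: "x = y \<or> rank x < rank y" if "(x, y) \<in> r\<^sup>*" for x y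
    using that
  proof induction
    case (step y z)
    then show ?case using assms[of y z] by auto
  qed simp
  have "antisym (r\<^sup>* \<inter> A \<times> A)"
  proof (rule antisymI)
    fix x y assume "(x, y) \<in> r\<^sup>* \<inter> A \<times> A" "(y, x) \<in> r\<^sup>* \<inter> A \<times> A"
    then show "x = y" using rank[of x y] rank[of y x] by auto
  qed
  moreover have "trans (r\<^sup>* \<inter> A \<times> A)"
  proof (rule transI)
    fix x y z assume "(x, y) \<in> r\<^sup>* \<inter> A \<times> A" "(y, z) \<in> r\<^sup>* \<inter> A \<times> A"
    then show "(x, z) \<in> r\<^sup>* \<inter> A \<times> A" using rtrancl_trans[of x y r z] by blast
  qed
  moreover have "refl_on A (r\<^sup>* \<inter> A \<times> A)"
    by (rule refl_onI) simp
  ultimately show ?thesis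
    by (simp add: partial_order_on_def preorder_on_def)
qed

lemma partial_order_bipath: "partial_order_on (bipath_set n m) (bipath n m)"
  unfolding bipath_def
  by (rule partial_order_on_restricted_rtrancl
        [where rank = "\<lambda>x. case x of Bot \<Rightarrow> 0 | Top \<Rightarrow> n + m + 1 | Up i \<Rightarrow> i | Dn i \<Rightarrow> i"])
    (auto simp: bipath_gen_def)

lemma partial_order_zprime: "partial_order_on (zprime_set n m) (zprime n m)"
  unfolding zprime_def
  by (rule partial_order_on_restricted_rtrancl
        [where rank = "\<lambda>z. case z of Bar1 \<Rightarrow> n + m + 1 | Pt x \<Rightarrow>
           (case x of Bot \<Rightarrow> 0 | Top \<Rightarrow> n + m + 1 | Up i \<Rightarrow> i | Dn i \<Rightarrow> i)"])
    (auto simp: zprime_gen_def)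

lemma zeta_mono:
  assumes "(z, w) \<in> zprime n m"
  shows "(zeta z, zeta w) \<in> bipath n m"
proof -
  have gen: "(zeta a, zeta b) \<in> bipath_gen n m" if "(a, b) \<in> zprime_gen n m" for a b
    using that by (auto simp: zprime_gen_def bipath_gen_def)
  have "(zeta z, zeta b) \<in> (bipath_gen n m)\<^sup>*" if "(z, b) \<in> (zprime_gen n m)\<^sup>*" for b
    using that by induction (auto intro: rtrancl_into_rtrancl gen)
  moreover have "zeta a \<in> bipath_set n m" if "a \<in> zprime_set n m" for a
    using that by (auto simp: zprime_set_def bipath_set_def)
  ultimately show ?thesis
    using assms unfolding zprime_def bipath_def by blast
qed

end

theory Submission
  imports Defs
begin

text \<open>
  Every interval \<open>I\<close> in question has a least element \<open>b\<close>. For an interval module \<open>L\<close> with this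
  property, \<open>End L = k\<close>, and a module \<open>N\<close> has a direct summand \<open>L\<close> iff some composite
  \<open>L \<rightarrow> N \<rightarrow> L\<close> is nonzero. Hence the rank of the pairing of \<open>Hom L N\<close> and \<open>Hom N L\<close> given by
  composition is additive in \<open>N\<close>, is 1 for \<open>N = L\<close> and 0 for other indecomposables, and so equals
  both multiplicities.

  The pairing only depends on the components at \<open>b\<close>. The possible components at \<open>b\<close> of maps out
  of \<open>L\<close> are the vectors that die outside of \<open>I\<close>, and these are the same before and after
  restriction. So are the possible components at \<open>b\<close> of maps into \<open>L\<close>: a map of restricted
  modules can disagree at the two elements over \<open>Top\<close> only if \<open>I\<close> is the whole poset, and then its
  component at \<open>Bot\<close> factors through \<open>M Top\<close> by either of them.
\<close>

section \<open>Linear maps and dimensions of finite-dimensional subspaces\<close>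

text \<open>Both multiplicities are defined by \<open>THE\<close>, so existence and uniqueness have
  to be shown for each. An additive natural-number invariant that detects the interval module gives
  uniqueness at once and stands in for the Krull-Schmidt theorem. Decomposing M and restricting its
  parts would not suffice by itself: after restriction a map may act differently on the two copies
  of the space at \<open>Top\<close>, so the restriction of an indecomposable module can split
  further and might produce new copies of R'(V_I). The pairing excludes this because it only sees
  vectors in a single space. As V_I is generated at its least element b, a map out of it is one
  vector of the space at b, and a map into it is tested by its functional on that space. The
  intervals in the statement are those whose preimage in Z' keeps a least element: an interval
  containing \<open>Top\<close> but not \<open>Bot\<close> has a disconnected preimage.\<close>

definition fd_subspace :: "('k::field \<Rightarrow> 'v \<Rightarrow> 'v) \<Rightarrow> 'v::ab_group_add set \<Rightarrow> bool" where
  "fd_subspace s V \<longleftrightarrow> vector_space s \<and> (\<exists>B. finite B \<and> V = module.span s B)"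

lemma fd_subspaceD:
  assumes "fd_subspace s V"
  shows "vector_space s" and "module.subspace s V"
proof -
  show "vector_space s" using assms by (simp add: fd_subspace_def)
  then interpret vector_space s .
  show "subspace V" using assms by (auto simp: fd_subspace_def)
qed

lemma fd_subspace_closed:
  assumes "fd_subspace s V"
  shows "0 \<in> V" "u \<in> V \<Longrightarrow> v \<in> V \<Longrightarrow> u + v \<in> V" "u \<in> V \<Longrightarrow> v \<in> V \<Longrightarrow> u - v \<in> V"
    "v \<in> V \<Longrightarrow> s a v \<in> V"
proof -
  interpret vector_space s using assms by (rule fd_subspaceD)
  have "subspace V" using assms by (rule fd_subspaceD)
  then show "0 \<in> V" "u \<in> V \<Longrightarrow> v \<in> V \<Longrightarrow> u + v \<in> V" "u \<in> V \<Longrightarrow> v \<in> V \<Longrightarrow> u - v \<in> V"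
    "v \<in> V \<Longrightarrow> s a v \<in> V"
    by (auto intro: subspace_0 subspace_add subspace_diff subspace_scale)
qed

text \<open>The ambient space may be infinite-dimensional. Finiteness of an independent subset of
  \<open>S\<close> comes from the exchange bound against the finite spanning set of
  \<open>V\<close>.\<close>

lemma fd_subspace_basis:
  assumes "fd_subspace s V" and "module.subspace s S" and "S \<subseteq> V"
  obtains B where "finite B" "B \<subseteq> S" "S = module.span s B" "\<not> module.dependent s B"
    "card B = vector_space.dim s S"
proof -
  interpret vector_space s using assms(1) by (rule fd_subspaceD)
  obtain C where C: "finite C" "V = span C"
    using assms(1) by (auto simp: fd_subspace_def)
  obtain B where B: "B \<subseteq> S" "independent B" "S \<subseteq> span B" "card B = dim S"
    by (rule basis_exists)
  have "finite B"
    using independent_span_bound[OF C(1) B(2)] B(1) C(2) assms(3) by auto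
  moreover have "S = span B"
    using B assms(2) span_minimal by blast
  ultimately show thesis using B that by blast
qed

lemma fd_subspace_mono:
  assumes "fd_subspace s V" and "module.subspace s S" and "S \<subseteq> V"
  shows "fd_subspace s S"
  using fd_subspace_basis[OF assms] assms(1) unfolding fd_subspace_def by metis

text \<open>For the equality case: a vector outside \<open>S\<close> would extend a basis of
  \<open>S\<close> to an independent set with more elements than a basis of
  \<open>V\<close>.\<close>

lemma dim_mono_fd:
  assumes "fd_subspace s V" and "module.subspace s S" and "S \<subseteq> V"
  shows "vector_space.dim s S \<le> vector_space.dim s V"
    and "vector_space.dim s S = vector_space.dim s V \<Longrightarrow> S = V"
proof -
  interpret vector_space s using assms(1) by (rule fd_subspaceD)
  have V: "subspace V" using assms(1) by (rule fd_subspaceD)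
  obtain B where B: "finite B" "B \<subseteq> S" "S = span B" "independent B" "card B = dim S"
    by (rule fd_subspace_basis[OF assms])
  obtain C where C: "finite C" "C \<subseteq> V" "V = span C" "independent C" "card C = dim V"
    by (rule fd_subspace_basis[OF assms(1) V order_refl])
  show "dim S \<le> dim V"
    using independent_span_bound[OF C(1) B(4)] B C assms(3) by auto
  show "S = V" if eq: "dim S = dim V"
  proof (rule ccontr)
    assume "S \<noteq> V"
    then obtain v where v: "v \<in> V" "v \<notin> S" using assms(3) by blast
    then have "independent (insert v B)"
      using B by (intro independent_insertI) auto
    moreover have "insert v B \<subseteq> span C" using v B C assms(3) by auto
    ultimately have "card (insert v B) \<le> card C"
      using independent_span_bound[OF C(1)] by auto
    moreover have "v \<notin> B" using v B by auto
    ultimately show False using B C eq by simp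
  qed
qed

lemma dim_pos_fd:
  assumes "fd_subspace s V" and "V \<noteq> {0}"
  shows "vector_space.dim s V > 0"
proof -
  interpret vector_space s using assms(1) by (rule fd_subspaceD)
  have "0 \<in> V" using assms(1) by (rule fd_subspace_closed)
  have "dim {0} = card ({} :: 'b set)" by (rule dim_eq_card) (auto simp: span_singleton independent_empty)
  then show ?thesis
    using dim_mono_fd(2)[OF assms(1), of "{0}"] \<open>0 \<in> V\<close> assms(2) by (cases "dim V = 0") auto
qed

lemma linear_between_0:
  assumes "fd_subspace s V" and "vector_space t" and "linear_between s V t W f"
  shows "f 0 = 0"
proof -
  interpret vector_space t by fact
  interpret s: vector_space s using assms(1) by (rule fd_subspaceD)
  have "0 \<in> V" using assms(1) by (rule fd_subspace_closed)
  then have "f (s 0 0) = t 0 (f 0)" using assms(3) unfolding linear_between_def by blast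
  then show ?thesis by simp
qed

lemma linear_between_diff:
  assumes "fd_subspace s V" and "vector_space t" and "linear_between s V t W f"
    and "u \<in> V" "v \<in> V"
  shows "f (u - v) = f u - f v"
proof -
  have "u - v \<in> V" using assms fd_subspace_closed by blast
  then have "f (u - v + v) = f (u - v) + f v"
    using assms unfolding linear_between_def by blast
  then show ?thesis by simp
qed

lemma linear_between_comp:
  assumes "linear_between s V t W f" and "linear_between t W u X g"
  shows "linear_between s V u X (\<lambda>v. g (f v))"
  using assms by (simp add: linear_between_def)

lemma linear_between_inv:
  assumes "fd_subspace s V" and "linear_between s V t W f" and "bij_betw f V W"
  shows "linear_between t W s V (inv_into V f)"
  unfolding linear_between_def
proof (intro conjI ballI allI)
  have inj: "inj_on f V" and im: "f ` V = W" using assms(3) by (auto simp: bij_betw_def)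
  show "inv_into V f w \<in> V" if "w \<in> W" for w
    using that im by (metis inv_into_into)
  show "inv_into V f (u + v) = inv_into V f u + inv_into V f v" if uv: "u \<in> W" "v \<in> W" for u v
  proof -
    obtain a b where ab: "a \<in> V" "b \<in> V" "u = f a" "v = f b" using uv im by blast
    then have "u + v = f (a + b)" using assms(2) by (simp add: linear_between_def)
    then show ?thesis
      using ab inj fd_subspace_closed(2)[OF assms(1)] by (simp add: inv_into_f_f)
  qed
  show "inv_into V f (t c v) = s c (inv_into V f v)" if v: "v \<in> W" for c v
  proof -
    obtain b where b: "b \<in> V" "v = f b" using v im by blast
    then have "t c v = f (s c b)" using assms(2) by (simp add: linear_between_def)
    then show ?thesis
      using b inj fd_subspace_closed(4)[OF assms(1)] by (simp add: inv_into_f_f)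
  qed
qed

lemma fd_subspace_image:
  assumes V: "fd_subspace s V" and t: "vector_space t" and f: "linear_between s V t W f"
    and im: "f ` V = W"
  shows "fd_subspace t W" and "vector_space.dim t W \<le> vector_space.dim s V"
proof -
  interpret s: vector_space s using V by (rule fd_subspaceD)
  interpret t: vector_space t by fact
  obtain B where B: "finite B" "B \<subseteq> V" "V = s.span B" "s.independent B" "card B = s.dim V"
    using fd_subspace_basis[OF V fd_subspaceD(2)[OF V] order_refl] .
  \<comment> \<open>Membership in \<open>V\<close> is carried through the span induction because
    \<open>f\<close> is known to be additive only there.\<close>
  have mem: "v \<in> V \<and> f v \<in> t.span (f ` B)" if "v \<in> s.span B" for v
    using that
  proof (induction rule: s.span_induct_alt)
    case base
    then show ?case using linear_between_0[OF V t f] t.span_zero fd_subspace_closed(1)[OF V] by simp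
  next
    case (step c x y)
    then have "x \<in> V" "y \<in> V" "s c x \<in> V" "s c x + y \<in> V"
      using B(2) fd_subspace_closed[OF V] by blast+
    then have "f (s c x + y) = t c (f x) + f y" using f by (simp add: linear_between_def)
    then show ?case
      using step \<open>s c x + y \<in> V\<close> by (simp add: t.span_add t.span_scale t.span_base)
  qed
  have sub: "t.subspace W"
  proof (rule t.subspaceI)
    show "0 \<in> W" using linear_between_0[OF V t f] fd_subspace_closed(1)[OF V] im by force
    show "u + v \<in> W" if uv: "u \<in> W" "v \<in> W" for u v
    proof -
      obtain a b where ab: "a \<in> V" "b \<in> V" "u = f a" "v = f b" using uv im by blast
      then have "u + v = f (a + b)" using f by (simp add: linear_between_def)
      then show ?thesis using ab im fd_subspace_closed(2)[OF V] by blast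
    qed
    show "t c v \<in> W" if v: "v \<in> W" for c v
    proof -
      obtain b where b: "b \<in> V" "v = f b" using v im by blast
      then have "t c v = f (s c b)" using f by (simp add: linear_between_def)
      then show ?thesis using b im fd_subspace_closed(4)[OF V] by blast
    qed
  qed
  have sp: "W = t.span (f ` B)"
  proof
    show "W \<subseteq> t.span (f ` B)" using mem B(3) im by blast
    show "t.span (f ` B) \<subseteq> W" using sub B(2) im by (intro t.span_minimal) auto
  qed
  then show "fd_subspace t W" using B(1) t unfolding fd_subspace_def by blast
  have "t.dim W \<le> card (f ` B)" using sp B(1) by (intro t.dim_le_card) auto
  also have "\<dots> \<le> card B" using B(1) by (rule card_image_le)
  finally show "t.dim W \<le> s.dim V" using B by simp
qed

text \<open>Taking images does not raise the dimension; this is applied to \<open>f\<close> and to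
  its inverse.\<close>

lemma dim_bij_betw:
  assumes V: "fd_subspace s V" and t: "vector_space t" and f: "linear_between s V t W f"
    and bij: "bij_betw f V W"
  shows "vector_space.dim t W = vector_space.dim s V"
proof (rule antisym)
  have im: "f ` V = W" using bij by (simp add: bij_betw_def)
  note W = fd_subspace_image[OF V t f im]
  show "vector_space.dim t W \<le> vector_space.dim s V" by (rule W)
  show "vector_space.dim s V \<le> vector_space.dim t W"
    using fd_subspace_image(2)[OF W(1) fd_subspaceD(1)[OF V] linear_between_inv[OF V f bij]]
      bij_betw_inv_into[OF bij] by (simp add: bij_betw_def)
qed

lemma prod_scale:
  assumes "vector_space s" and "vector_space t"
  shows "module_prod.scale s t a v = (s a (fst v), t a (snd v))"
    and "vector_space (module_prod.scale s t)"
proof -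
  interpret vector_space_prod s t
    using assms by (simp add: vector_space_prod_def vector_space_pair_def)
  show "scale a v = (s a (fst v), t a (snd v))" by (simp add: scale_def)
  show "vector_space scale" by (rule p.vector_space_axioms)
qed

lemma fd_subspace_Times:
  assumes V: "fd_subspace s V" and W: "fd_subspace t W"
  shows "fd_subspace (module_prod.scale s t) (V \<times> W)"
    and "vector_space.dim (module_prod.scale s t) (V \<times> W) =
      vector_space.dim s V + vector_space.dim t W"
proof -
  interpret vector_space_prod s t
    using fd_subspaceD[OF V] fd_subspaceD[OF W]
    by (simp add: vector_space_prod_def vector_space_pair_def)
  obtain B where B: "finite B" "B \<subseteq> V" "V = vs1.span B" "vs1.independent B" "card B = vs1.dim V"
    using fd_subspace_basis[OF V fd_subspaceD(2)[OF V] order_refl] .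
  obtain C where C: "finite C" "C \<subseteq> W" "W = vs2.span C" "vs2.independent C" "card C = vs2.dim W"
    using fd_subspace_basis[OF W fd_subspaceD(2)[OF W] order_refl] .
  let ?D = "B \<times> {0} \<union> {0} \<times> C"
  have sp: "p.span (X \<times> {0} \<union> {0} \<times> Y) = vs1.span X \<times> vs2.span Y" for X Y
    by (auto simp: p.span_Un span_Times_sing1 span_Times_sing2)
  \<comment> \<open>Since 0 lies in neither basis, the two embedded copies are disjoint, and
    removing a vector from one of them leaves the other intact.\<close>
  have B0: "0 \<notin> B" and C0: "0 \<notin> C" using B C vs1.dependent_zero vs2.dependent_zero by auto
  have ind: "p.independent ?D"
    unfolding p.dependent_def
  proof safe
    fix a assume a: "a \<in> B" "(a, 0) \<in> p.span (?D - {(a, 0)})"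
    have "?D - {(a, 0)} = (B - {a}) \<times> {0} \<union> {0} \<times> C" using B0 C0 a by auto
    with a sp have "a \<in> vs1.span (B - {a})" by simp
    then show False using a B by (auto simp: vs1.dependent_def)
  next
    fix a assume a: "a \<in> C" "(0, a) \<in> p.span (?D - {(0, a)})"
    have "?D - {(0, a)} = B \<times> {0} \<union> {0} \<times> (C - {a})" using B0 C0 a by auto
    with a sp have "a \<in> vs2.span (C - {a})" by simp
    then show False using a C by (auto simp: vs2.dependent_def)
  qed
  have fin: "finite ?D" using B C by simp
  show "fd_subspace scale (V \<times> W)"
    unfolding fd_subspace_def using p.vector_space_axioms fin sp[of B C] B C by metis
  have "p.dim (V \<times> W) = card ?D"
    using ind sp[of B C] B(3) C(3) p.span_span by (intro p.dim_eq_card) metis+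
  also have "\<dots> = card (B \<times> {0::'c}) + card ({0::'b} \<times> C)"
    using B C B0 by (intro card_Un_disjoint) auto
  finally show "p.dim (V \<times> W) = vs1.dim V + vs2.dim W" using B C by (simp add: card_cartesian_product)
qed

section \<open>Homomorphisms and direct sums of modules\<close>

lemma is_pmodule_axioms:
  fixes M :: "('k::field, 'x, 'v::ab_group_add) pmodule"
  assumes "is_pmodule P M"
  shows "vector_space (scalar M)"
    and "x \<in> Field P \<Longrightarrow> \<exists>B. finite B \<and> space_at M x = module.span (scalar M) B"
    and "x \<in> Field P \<Longrightarrow> y \<in> Field P \<Longrightarrow> c \<in> lin_hom P x y \<Longrightarrow>
      linear_between (scalar M) (space_at M x) (scalar M) (space_at M y) (action M x y c)"
    and "x \<in> Field P \<Longrightarrow> y \<in> Field P \<Longrightarrow> c \<in> lin_hom P x y \<Longrightarrow> d \<in> lin_hom P x y \<Longrightarrow>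
      v \<in> space_at M x \<Longrightarrow> action M x y (c + d) v = action M x y c v + action M x y d v"
    and "x \<in> Field P \<Longrightarrow> y \<in> Field P \<Longrightarrow> c \<in> lin_hom P x y \<Longrightarrow>
      v \<in> space_at M x \<Longrightarrow> action M x y (a * c) v = scalar M a (action M x y c v)"
    and "x \<in> Field P \<Longrightarrow> v \<in> space_at M x \<Longrightarrow> action M x x 1 v = v"
    and "x \<in> Field P \<Longrightarrow> y \<in> Field P \<Longrightarrow> z \<in> Field P \<Longrightarrow> c \<in> lin_hom P x y \<Longrightarrow> d \<in> lin_hom P y z \<Longrightarrow>
      v \<in> space_at M x \<Longrightarrow> action M x z (d * c) v = action M y z d (action M x y c v)"
  using assms by (simp_all add: is_pmodule_def)

text \<open>Between comparable elements every coefficient is a morphism, so the side conditions on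
  coefficients turn into order relations.\<close>

lemma is_pmoduleD:
  fixes M :: "('k::field, 'x, 'v::ab_group_add) pmodule"
  assumes "is_pmodule P M"
  shows "vector_space (scalar M)"
    and "x \<in> Field P \<Longrightarrow> fd_subspace (scalar M) (space_at M x)"
    and "(x, y) \<in> P \<Longrightarrow>
      linear_between (scalar M) (space_at M x) (scalar M) (space_at M y) (action M x y c)"
    and "(x, y) \<in> P \<Longrightarrow> v \<in> space_at M x \<Longrightarrow> action M x y c v \<in> space_at M y"
    and "(x, y) \<in> P \<Longrightarrow> v \<in> space_at M x \<Longrightarrow>
      action M x y (c + d) v = action M x y c v + action M x y d v"
    and "(x, y) \<in> P \<Longrightarrow> v \<in> space_at M x \<Longrightarrow>
      action M x y (a * c) v = scalar M a (action M x y c v)"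
    and "x \<in> Field P \<Longrightarrow> v \<in> space_at M x \<Longrightarrow> action M x x 1 v = v"
    and "(x, y) \<in> P \<Longrightarrow> (y, z) \<in> P \<Longrightarrow> (x, z) \<in> P \<Longrightarrow> v \<in> space_at M x \<Longrightarrow>
      action M x z (d * c) v = action M y z d (action M x y c v)"
proof -
  have F: "x \<in> Field P \<and> y \<in> Field P \<and> lin_hom P x y = (UNIV :: 'k set)" if "(x, y) \<in> P" for x y
    using that by (auto simp: Field_def lin_hom_def)
  note D = is_pmodule_axioms[OF assms]
  show "vector_space (scalar M)" by (rule D)
  show "fd_subspace (scalar M) (space_at M x)" if "x \<in> Field P"
    using D(1) D(2)[OF that] by (simp add: fd_subspace_def)
  show lin: "linear_between (scalar M) (space_at M x) (scalar M) (space_at M y) (action M x y c)"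
    if "(x, y) \<in> P" for x y c
    using F[OF that] by (intro D(3)) auto
  show "action M x y c v \<in> space_at M y" if "(x, y) \<in> P" "v \<in> space_at M x"
    using lin[OF that(1)] that(2) by (simp add: linear_between_def)
  show "action M x y (c + d) v = action M x y c v + action M x y d v"
    if "(x, y) \<in> P" "v \<in> space_at M x"
    using F[OF that(1)] that(2) by (intro D(4)) auto
  show "action M x y (a * c) v = scalar M a (action M x y c v)"
    if "(x, y) \<in> P" "v \<in> space_at M x"
    using F[OF that(1)] that(2) by (intro D(5)) auto
  show "action M x x 1 v = v" if "x \<in> Field P" "v \<in> space_at M x"
    using that by (rule D)
  show "action M x z (d * c) v = action M y z d (action M x y c v)"
    if "(x, y) \<in> P" "(y, z) \<in> P" "(x, z) \<in> P" "v \<in> space_at M x"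
    using F[OF that(1)] F[OF that(2)] that(4) by (intro D(7)) auto
qed

text \<open>Linearity in the coefficient: \<open>c\<close> is \<open>c * 1\<close> on comparable
  pairs, and only \<open>c = 0\<close> occurs on the others. Coefficient 1 on comparable pairs thus
  determines the whole action, and later naturality checks are confined to it.\<close>

lemma action_lin_hom:
  assumes "is_pmodule P M" and "x \<in> Field P" and "y \<in> Field P" and "c \<in> lin_hom P x y"
    and "v \<in> space_at M x"
  shows "action M x y c v = (if (x, y) \<in> P then scalar M c (action M x y 1 v) else 0)"
proof (cases "(x, y) \<in> P")
  case True
  then show ?thesis using is_pmoduleD(6)[OF assms(1) True assms(5), of c 1] by simp
next
  case False
  interpret vector_space "scalar M" using assms(1) by (rule is_pmoduleD)
  have "c = 0" using False assms(4) by (simp add: lin_hom_def)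
  moreover have "action M x y (0 * c) v = scalar M 0 (action M x y c v)"
    using assms(2-5) by (rule is_pmodule_axioms[OF assms(1)])
  ultimately show ?thesis using False by simp
qed

lemma zero_in_space_at:
  assumes "is_pmodule P M" and "x \<in> Field P"
  shows "0 \<in> space_at M x"
  using is_pmoduleD(2)[OF assms] by (rule fd_subspace_closed)

lemma pmodule_homD:
  assumes "pmodule_hom P M N f"
  shows "x \<in> Field P \<Longrightarrow>
      linear_between (scalar M) (space_at M x) (scalar N) (space_at N x) (f x)"
    and "x \<in> Field P \<Longrightarrow> v \<in> space_at M x \<Longrightarrow> f x v \<in> space_at N x"
    and "x \<in> Field P \<Longrightarrow> u \<in> space_at M x \<Longrightarrow> v \<in> space_at M x \<Longrightarrow> f x (u + v) = f x u + f x v"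
    and "x \<in> Field P \<Longrightarrow> v \<in> space_at M x \<Longrightarrow> f x (scalar M a v) = scalar N a (f x v)"
    and "(x, y) \<in> P \<Longrightarrow> v \<in> space_at M x \<Longrightarrow> f y (action M x y c v) = action N x y c (f x v)"
proof -
  show lin: "linear_between (scalar M) (space_at M x) (scalar N) (space_at N x) (f x)"
    if "x \<in> Field P" for x
    using assms that unfolding pmodule_hom_def by blast
  show "f x v \<in> space_at N x" if "x \<in> Field P" "v \<in> space_at M x"
    using lin that unfolding linear_between_def by blast
  show "f x (u + v) = f x u + f x v"
    if "x \<in> Field P" "u \<in> space_at M x" "v \<in> space_at M x"
    using lin that unfolding linear_between_def by blast
  show "f x (scalar M a v) = scalar N a (f x v)" if "x \<in> Field P" "v \<in> space_at M x"
    using lin that unfolding linear_between_def by blast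
  show "f y (action M x y c v) = action N x y c (f x v)" if "(x, y) \<in> P" "v \<in> space_at M x"
  proof -
    have "x \<in> Field P" "y \<in> Field P" "c \<in> lin_hom P x y"
      using that(1) by (auto simp: Field_def lin_hom_def)
    then show ?thesis using assms that(2) unfolding pmodule_hom_def by blast
  qed
qed

lemma pmodule_hom_0:
  assumes "is_pmodule P M" and "is_pmodule P N" and "pmodule_hom P M N f" and "x \<in> Field P"
  shows "f x 0 = 0"
  using linear_between_0[OF is_pmoduleD(2)[OF assms(1,4)] is_pmoduleD(1)[OF assms(2)]]
    pmodule_homD(1)[OF assms(3,4)] .

lemma pmodule_homI:
  fixes M :: "('k::field, 'x, 'v::ab_group_add) pmodule"
    and N :: "('k, 'x, 'w::ab_group_add) pmodule"
  assumes M: "is_pmodule P M" and N: "is_pmodule P N"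
    and lin: "\<And>x. x \<in> Field P \<Longrightarrow>
      linear_between (scalar M) (space_at M x) (scalar N) (space_at N x) (f x)"
    and nat: "\<And>x y v. (x, y) \<in> P \<Longrightarrow> v \<in> space_at M x \<Longrightarrow>
      f y (action M x y 1 v) = action N x y 1 (f x v)"
  shows "pmodule_hom P M N f"
  unfolding pmodule_hom_def
proof (intro conjI ballI)
  fix x y v and c :: 'k
  assume x: "x \<in> Field P" and y: "y \<in> Field P" and c: "c \<in> lin_hom P x y"
    and v: "v \<in> space_at M x"
  have fv: "f x v \<in> space_at N x" using lin[OF x] v by (simp add: linear_between_def)
  show "f y (action M x y c v) = action N x y c (f x v)"
  proof (cases "(x, y) \<in> P")
    case True
    then have "action M x y 1 v \<in> space_at M y" using is_pmoduleD(4)[OF M] v by blast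
    then have "f y (scalar M c (action M x y 1 v)) = scalar N c (f y (action M x y 1 v))"
      using lin[OF y] by (simp add: linear_between_def)
    then show ?thesis
      using action_lin_hom[OF M x y c v] action_lin_hom[OF N x y c fv] nat[OF True v] True by simp
  next
    case False
    then show ?thesis
      using action_lin_hom[OF M x y c v] action_lin_hom[OF N x y c fv]
        linear_between_0[OF is_pmoduleD(2)[OF M y] is_pmoduleD(1)[OF N] lin[OF y]] by simp
  qed
qed (rule lin)

lemma pmodule_hom_id: "pmodule_hom P M M (\<lambda>x v. v)"
  by (simp add: pmodule_hom_def linear_between_def)

lemma pmodule_hom_comp:
  assumes "pmodule_hom P M N f" and "pmodule_hom P N K g"
  shows "pmodule_hom P M K (\<lambda>x v. g x (f x v))"
  using assms unfolding pmodule_hom_def linear_between_def by simp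

lemma pmodule_isoE:
  assumes "pmodule_iso P M N"
  obtains f where "pmodule_hom P M N f"
    and "\<And>x. x \<in> Field P \<Longrightarrow> bij_betw (f x) (space_at M x) (space_at N x)"
  using assms by (auto simp: pmodule_iso_def)

lemma pmodule_iso_refl: "pmodule_iso P M M"
  unfolding pmodule_iso_def using pmodule_hom_id by (intro exI[of _ "\<lambda>x v. v"]) (auto simp: bij_betw_def)

lemma pmodule_iso_trans:
  assumes "pmodule_iso P M N" and "pmodule_iso P N K"
  shows "pmodule_iso P M K"
proof -
  obtain f where f: "pmodule_hom P M N f"
    "\<And>x. x \<in> Field P \<Longrightarrow> bij_betw (f x) (space_at M x) (space_at N x)"
    using assms(1) by (rule pmodule_isoE) blast
  obtain g where g: "pmodule_hom P N K g"
    "\<And>x. x \<in> Field P \<Longrightarrow> bij_betw (g x) (space_at N x) (space_at K x)"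
    using assms(2) by (rule pmodule_isoE) blast
  have "bij_betw (\<lambda>v. g x (f x v)) (space_at M x) (space_at K x)" if "x \<in> Field P" for x
    using bij_betw_trans[OF f(2)[OF that] g(2)[OF that]] by (simp add: o_def)
  then show ?thesis
    unfolding pmodule_iso_def using pmodule_hom_comp[OF f(1) g(1)] by blast
qed

lemma pmodule_iso_inv:
  assumes M: "is_pmodule P M" and N: "is_pmodule P N" and f: "pmodule_hom P M N f"
    and bij: "\<And>x. x \<in> Field P \<Longrightarrow> bij_betw (f x) (space_at M x) (space_at N x)"
  shows "pmodule_hom P N M (\<lambda>x. inv_into (space_at M x) (f x))"
proof (rule pmodule_homI[OF N M])
  show "linear_between (scalar N) (space_at N x) (scalar M) (space_at M x)
      (inv_into (space_at M x) (f x))" if "x \<in> Field P" for x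
    using linear_between_inv[OF is_pmoduleD(2)[OF M that] pmodule_homD(1)[OF f that] bij[OF that]] .
  fix x y w assume xy: "(x, y) \<in> P" and w: "w \<in> space_at N x"
  have x: "x \<in> Field P" and y: "y \<in> Field P" using xy by (auto simp: Field_def)
  obtain v where v: "v \<in> space_at M x" "w = f x v"
    using bij[OF x] w by (auto simp: bij_betw_def)
  have "action N x y 1 w = f y (action M x y 1 v)" using pmodule_homD(5)[OF f xy v(1)] v by simp
  then show "inv_into (space_at M y) (f y) (action N x y 1 w) =
      action M x y 1 (inv_into (space_at M x) (f x) w)"
    using v bij[OF x] bij[OF y] is_pmoduleD(4)[OF M xy v(1)]
    by (simp add: bij_betw_def inv_into_f_f)
qed

lemma pmodule_iso_sym:
  assumes "is_pmodule P M" and "is_pmodule P N" and "pmodule_iso P M N"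
  shows "pmodule_iso P N M"
proof -
  obtain f where f: "pmodule_hom P M N f"
    "\<And>x. x \<in> Field P \<Longrightarrow> bij_betw (f x) (space_at M x) (space_at N x)"
    using assms(3) by (rule pmodule_isoE) blast
  then show ?thesis
    unfolding pmodule_iso_def using pmodule_iso_inv[OF assms(1,2) f] bij_betw_inv_into by blast
qed

text \<open>Images and kernels are built this way on the ambient type of \<open>M\<close>, the type
  over which \<open>indecomposable\<close> and \<open>has_summand\<close> let summands
  range.\<close>

lemma is_pmodule_submodule:
  assumes M: "is_pmodule P M"
    and S: "\<And>x. x \<in> Field P \<Longrightarrow> module.subspace (scalar M) (S x)"
    and sub: "\<And>x. x \<in> Field P \<Longrightarrow> S x \<subseteq> space_at M x"
    and act: "\<And>x y v. (x, y) \<in> P \<Longrightarrow> v \<in> S x \<Longrightarrow> action M x y 1 v \<in> S y"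
  shows "is_pmodule P (M\<lparr>space_at := S\<rparr>)"
proof -
  interpret vector_space "scalar M" using M by (rule is_pmoduleD)
  have fd: "\<exists>B. finite B \<and> S x = span B" if "x \<in> Field P" for x
    using fd_subspace_mono[OF is_pmoduleD(2)[OF M that] S[OF that] sub[OF that]]
    by (simp add: fd_subspace_def)
  have act': "action M x y c v \<in> S y"
    if "x \<in> Field P" "y \<in> Field P" "c \<in> lin_hom P x y" "v \<in> S x" for x y c v
    using action_lin_hom[OF M that(1-3)] sub[OF that(1)] act[of x y v] S[OF that(2)] that(4)
    by (auto simp: subspace_0 subspace_scale)
  have lin: "linear_between (scalar M) (S x) (scalar M) (S y) (action M x y c)"
    if "x \<in> Field P" "y \<in> Field P" "c \<in> lin_hom P x y" for x y c
  proof -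
    have "linear_between (scalar M) (space_at M x) (scalar M) (space_at M y) (action M x y c)"
      using that by (rule is_pmodule_axioms[OF M])
    then show ?thesis using act'[OF that] sub[OF that(1)] unfolding linear_between_def by blast
  qed
  have sub': "v \<in> space_at M x" if "x \<in> Field P" "v \<in> S x" for x v
    using sub that by blast
  show ?thesis
    unfolding is_pmodule_def
    using is_pmodule_axioms(7)[OF M]
    by (auto simp: is_pmodule_axioms(1,4-6)[OF M] fd lin sub')
qed

lemma pmodule_hom_submodule:
  assumes "pmodule_hom P M N f"
    and "\<And>x v. x \<in> Field P \<Longrightarrow> v \<in> space_at M x \<Longrightarrow> f x v \<in> S x"
  shows "pmodule_hom P M (N\<lparr>space_at := S\<rparr>) f"
  using assms by (simp add: pmodule_hom_def linear_between_def)

section \<open>Binary direct sums\<close>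

lemma direct_sum_sel [simp]:
  "space_at (direct_sum M N) x = space_at M x \<times> space_at N x"
  "action (direct_sum M N) x y c v = (action M x y c (fst v), action N x y c (snd v))"
  by (auto simp: direct_sum_def map_prod_def split: prod.split)

lemma scalar_direct_sum:
  assumes "is_pmodule P M" and "is_pmodule P N"
  shows "scalar (direct_sum M N) a v = (scalar M a (fst v), scalar N a (snd v))"
  using prod_scale(1)[OF is_pmoduleD(1)[OF assms(1)] is_pmoduleD(1)[OF assms(2)]]
  by (simp add: direct_sum_def)

lemma is_pmodule_direct_sum:
  assumes M: "is_pmodule P M" and N: "is_pmodule P N"
  shows "is_pmodule P (direct_sum M N)"
proof -
  note vs = is_pmoduleD(1)[OF M] is_pmoduleD(1)[OF N]
  note sc = scalar_direct_sum[OF M N]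
  have "vector_space (scalar (direct_sum M N))"
    using prod_scale(2)[OF vs] by (simp add: direct_sum_def)
  moreover have "\<exists>B. finite B \<and> space_at M x \<times> space_at N x = module.span (scalar (direct_sum M N)) B"
    if "x \<in> Field P" for x
    using fd_subspace_Times(1)[OF is_pmoduleD(2)[OF M that] is_pmoduleD(2)[OF N that]]
    by (simp add: fd_subspace_def direct_sum_def)
  ultimately show ?thesis
    using M N unfolding is_pmodule_def linear_between_def
    by (auto simp: sc)
qed

lemma pmodule_hom_fst:
  assumes "is_pmodule P M" and "is_pmodule P N"
  shows "pmodule_hom P (direct_sum M N) M (\<lambda>x. fst)"
  by (auto simp: pmodule_hom_def linear_between_def scalar_direct_sum[OF assms])

lemma pmodule_hom_snd:
  assumes "is_pmodule P M" and "is_pmodule P N"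
  shows "pmodule_hom P (direct_sum M N) N (\<lambda>x. snd)"
  by (auto simp: pmodule_hom_def linear_between_def scalar_direct_sum[OF assms])

lemma pmodule_hom_Pair:
  assumes "is_pmodule P M" and "is_pmodule P N"
    and "pmodule_hom P K M f" and "pmodule_hom P K N g"
  shows "pmodule_hom P K (direct_sum M N) (\<lambda>x v. (f x v, g x v))"
  using assms(3,4) by (simp add: pmodule_hom_def linear_between_def scalar_direct_sum[OF assms(1,2)])

lemma pmodule_hom_zero:
  assumes "is_pmodule P M" and "is_pmodule P N"
  shows "pmodule_hom P M N (\<lambda>x v. 0)"
proof (rule pmodule_homI[OF assms])
  interpret vector_space "scalar N" using assms(2) by (rule is_pmoduleD)
  show "linear_between (scalar M) (space_at M x) (scalar N) (space_at N x) (\<lambda>v. 0)"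
    if "x \<in> Field P" for x
    using zero_in_space_at[OF assms(2) that] by (simp add: linear_between_def)
  show "0 = action N x y 1 0" if "(x, y) \<in> P" for x y
  proof -
    have x: "x \<in> Field P" using that by (auto simp: Field_def)
    show ?thesis
      using linear_between_0[OF is_pmoduleD(2)[OF assms(2) x] vector_space_axioms
          is_pmoduleD(3)[OF assms(2) that]] by simp
  qed
qed

text \<open>Serves to form the projection of a module onto a kernel in
  \<open>split_interval_module\<close>.\<close>

lemma pmodule_hom_sub_scale:
  assumes M: "is_pmodule P M" and N: "is_pmodule P N"
    and f: "pmodule_hom P M N f" and g: "pmodule_hom P M N g"
  shows "pmodule_hom P M N (\<lambda>x v. f x v - scalar N a (g x v))"
proof (rule pmodule_homI[OF M N])
  interpret vector_space "scalar N" using N by (rule is_pmoduleD)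
  show "linear_between (scalar M) (space_at M x) (scalar N) (space_at N x)
      (\<lambda>v. f x v - scalar N a (g x v))" if x: "x \<in> Field P" for x
    using pmodule_homD(2-4)[OF f x] pmodule_homD(2-4)[OF g x]
      fd_subspace_closed[OF is_pmoduleD(2)[OF N x]]
    by (simp add: linear_between_def algebra_simps)
  fix x y v assume xy: "(x, y) \<in> P" and v: "v \<in> space_at M x"
  have x: "x \<in> Field P" using xy by (auto simp: Field_def)
  note fd = is_pmoduleD(2)[OF N x] and lin = is_pmoduleD(3)[OF N xy, of 1]
  have fv: "f x v \<in> space_at N x" and gv: "g x v \<in> space_at N x"
    using pmodule_homD(2)[OF f x v] pmodule_homD(2)[OF g x v] .
  have "action N x y 1 (f x v - scalar N a (g x v)) =
      action N x y 1 (f x v) - action N x y 1 (scalar N a (g x v))"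
    using linear_between_diff[OF fd vector_space_axioms lin fv fd_subspace_closed(4)[OF fd gv]] .
  also have "action N x y 1 (scalar N a (g x v)) = scalar N a (action N x y 1 (g x v))"
    using lin gv unfolding linear_between_def by blast
  finally show "f y (action M x y 1 v) - scalar N a (g y (action M x y 1 v)) =
      action N x y 1 (f x v - scalar N a (g x v))"
    using pmodule_homD(5)[OF f xy v] pmodule_homD(5)[OF g xy v] by simp
qed

lemma pmodule_iso_direct_sum:
  assumes M: "is_pmodule P M" "is_pmodule P M'" and N: "is_pmodule P N" "is_pmodule P N'"
    and "pmodule_iso P M M'" and "pmodule_iso P N N'"
  shows "pmodule_iso P (direct_sum M N) (direct_sum M' N')"
proof -
  obtain f where f: "pmodule_hom P M M' f"
    "\<And>x. x \<in> Field P \<Longrightarrow> bij_betw (f x) (space_at M x) (space_at M' x)"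
    using assms(5) by (rule pmodule_isoE) blast
  obtain g where g: "pmodule_hom P N N' g"
    "\<And>x. x \<in> Field P \<Longrightarrow> bij_betw (g x) (space_at N x) (space_at N' x)"
    using assms(6) by (rule pmodule_isoE) blast
  have "pmodule_hom P (direct_sum M N) (direct_sum M' N') (\<lambda>x v. (f x (fst v), g x (snd v)))"
    using pmodule_hom_comp[OF pmodule_hom_fst[OF M(1) N(1)] f(1)]
      pmodule_hom_comp[OF pmodule_hom_snd[OF M(1) N(1)] g(1)]
    by (rule pmodule_hom_Pair[OF M(2) N(2)])
  moreover have "bij_betw (\<lambda>v. (f x (fst v), g x (snd v))) (space_at (direct_sum M N) x)
      (space_at (direct_sum M' N') x)" if "x \<in> Field P" for x
    using bij_betw_map_prod[OF f(2)[OF that] g(2)[OF that]]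
    by (simp add: map_prod_def case_prod_beta')
  ultimately show ?thesis unfolding pmodule_iso_def by blast
qed

text \<open>Finite sums grow at their right end; this moves a newly split-off module
  \<open>A\<close> to the right of the sum \<open>B\<close> that is to absorb it.\<close>

lemma pmodule_iso_direct_sum_left_commute:
  assumes "is_pmodule P A" and "is_pmodule P B" and "is_pmodule P C"
  shows "pmodule_iso P (direct_sum A (direct_sum B C)) (direct_sum (direct_sum B A) C)"
proof -
  note BC = is_pmodule_direct_sum[OF assms(2,3)] and BA = is_pmodule_direct_sum[OF assms(2,1)]
  let ?f = "\<lambda>(x :: 'a) v. ((fst (snd v), fst v), snd (snd v))"
  note p2 = pmodule_hom_snd[OF assms(1) BC]
  have "pmodule_hom P (direct_sum A (direct_sum B C)) (direct_sum (direct_sum B A) C) ?f"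
    by (intro pmodule_hom_Pair assms BA pmodule_hom_fst[OF assms(1) BC]
        pmodule_hom_comp[OF p2 pmodule_hom_fst[OF assms(2,3)]]
        pmodule_hom_comp[OF p2 pmodule_hom_snd[OF assms(2,3)]])
  moreover have "bij_betw (?f x) (space_at (direct_sum A (direct_sum B C)) x)
      (space_at (direct_sum (direct_sum B A) C) x)" for x
    by (rule bij_betw_byWitness[where f' = "\<lambda>v. (snd (fst v), (fst (fst v), snd v))"]) auto
  ultimately show ?thesis unfolding pmodule_iso_def by blast
qed

section \<open>Finite direct sums\<close>

lemma finite_direct_sum_sel [simp]:
  "scalar (finite_direct_sum r F) a f i = scalar (F i) a (f i)"
  "f \<in> space_at (finite_direct_sum r F) x \<longleftrightarrow>
    (\<forall>i<r. f i \<in> space_at (F i) x) \<and> (\<forall>i\<ge>r. f i = 0)"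
  "action (finite_direct_sum r F) x y c f i = (if i < r then action (F i) x y c (f i) else 0)"
  by (simp_all add: finite_direct_sum_def)

lemma scalar_zero:
  assumes "is_pmodule P M"
  shows "scalar M a 0 = 0"
proof -
  interpret vector_space "scalar M" using assms by (rule is_pmoduleD)
  show ?thesis by simp
qed

text \<open>The passage from \<open>r\<close> to \<open>r + 1\<close> summands, stated for raw
  spaces: finite-dimensionality of a finite sum is derived from it, so the facts about
  \<open>direct_sum\<close> of modules cannot be used yet.\<close>

lemma linear_between_extend_finite_direct_sum:
  assumes "\<And>i. is_pmodule P (F i)"
  shows "linear_between
    (module_prod.scale (scalar (finite_direct_sum r F)) (scalar (F r)))
    (space_at (finite_direct_sum r F) x \<times> space_at (F r) x)
    (scalar (finite_direct_sum (Suc r) F)) (space_at (finite_direct_sum (Suc r) F) x)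
    (\<lambda>v. (fst v)(r := snd v))"
  and "bij_betw (\<lambda>v. (fst v)(r := snd v)) (space_at (finite_direct_sum r F) x \<times> space_at (F r) x)
    (space_at (finite_direct_sum (Suc r) F) x)"
proof -
  have "vector_space (scalar (finite_direct_sum r F))"
    using is_pmoduleD(1)[OF assms]
    by (auto simp: vector_space_def finite_direct_sum_def fun_eq_iff)
  note sc = prod_scale(1)[OF this is_pmoduleD(1)[OF assms, of r]]
  show "linear_between
    (module_prod.scale (scalar (finite_direct_sum r F)) (scalar (F r)))
    (space_at (finite_direct_sum r F) x \<times> space_at (F r) x)
    (scalar (finite_direct_sum (Suc r) F)) (space_at (finite_direct_sum (Suc r) F) x)
    (\<lambda>v. (fst v)(r := snd v))"
    by (auto simp: linear_between_def sc fun_eq_iff less_Suc_eq)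
  show "bij_betw (\<lambda>v. (fst v)(r := snd v)) (space_at (finite_direct_sum r F) x \<times> space_at (F r) x)
    (space_at (finite_direct_sum (Suc r) F) x)"
    by (rule bij_betw_byWitness[where f' = "\<lambda>f. (f(r := 0), f r)"])
      (auto simp: fun_eq_iff less_Suc_eq)
qed

lemma is_pmodule_finite_direct_sum:
  fixes F :: "nat \<Rightarrow> ('k::field, 'x, 'v::ab_group_add) pmodule"
  assumes F: "\<And>i. is_pmodule P (F i)"
  shows "is_pmodule P (finite_direct_sum r F)"
proof -
  have vs: "vector_space (scalar (finite_direct_sum r F))" for r
    using is_pmoduleD(1)[OF F] by (auto simp: vector_space_def finite_direct_sum_def fun_eq_iff)
  have fd: "fd_subspace (scalar (finite_direct_sum r F)) (space_at (finite_direct_sum r F) x)"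
    if x: "x \<in> Field P" for x
  proof (induction r)
    case 0
    interpret vector_space "scalar (finite_direct_sum 0 F)" by (rule vs)
    have "space_at (finite_direct_sum 0 F) x = {0}"
      by (auto simp: finite_direct_sum_def fun_eq_iff)
    then have "space_at (finite_direct_sum 0 F) x = span {}" by simp
    then show ?case unfolding fd_subspace_def using vs by blast
  next
    case (Suc r)
    show ?case
      using fd_subspace_image(1)[OF fd_subspace_Times(1)[OF Suc is_pmoduleD(2)[OF F x]] vs]
        linear_between_extend_finite_direct_sum[of P F, OF F, of r x]
      unfolding bij_betw_def by blast
  qed
  show ?thesis
    unfolding is_pmodule_def
  proof (intro conjI ballI allI)
    show "\<exists>B. finite B \<and> space_at (finite_direct_sum r F) x =
        module.span (scalar (finite_direct_sum r F)) B" if "x \<in> Field P" for x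
      using fd[OF that] by (simp add: fd_subspace_def)
  next
    fix x y and c :: 'k assume "x \<in> Field P" "y \<in> Field P" "c \<in> lin_hom P x y"
    then show "linear_between (scalar (finite_direct_sum r F)) (space_at (finite_direct_sum r F) x)
        (scalar (finite_direct_sum r F)) (space_at (finite_direct_sum r F) y)
        (action (finite_direct_sum r F) x y c)"
      using is_pmodule_axioms(3)[OF F] by (auto simp: linear_between_def fun_eq_iff scalar_zero[OF F])
  qed (use vs in \<open>auto simp: fun_eq_iff is_pmodule_axioms(4-6)[OF F] scalar_zero[OF F]
      intro: is_pmodule_axioms(7)[OF F]\<close>)
qed

lemma pmodule_iso_finite_direct_sum_Suc:
  assumes F: "\<And>i. is_pmodule P (F i)"
  shows "pmodule_iso P (direct_sum (finite_direct_sum r F) (F r)) (finite_direct_sum (Suc r) F)"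
proof -
  have "pmodule_hom P (direct_sum (finite_direct_sum r F) (F r)) (finite_direct_sum (Suc r) F)
      (\<lambda>x v. (fst v)(r := snd v))"
    unfolding pmodule_hom_def
    using linear_between_extend_finite_direct_sum(1)[of P F, OF F, of r]
    by (auto simp: direct_sum_def fun_eq_iff less_Suc_eq)
  then show ?thesis
    unfolding pmodule_iso_def
    using linear_between_extend_finite_direct_sum(2)[of P F, OF F, of r]
    by (intro exI[of _ "\<lambda>x v. (fst v)(r := snd v)"]) auto
qed

lemma pmodule_iso_finite_direct_sum_append:
  assumes F: "\<And>i. is_pmodule P (F i)" and G: "\<And>i. is_pmodule P (G i)"
  shows "pmodule_iso P (direct_sum (finite_direct_sum l F) (finite_direct_sum l' G))
    (finite_direct_sum (l + l') (\<lambda>i. if i < l then F i else G (i - l)))"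
proof -
  let ?H = "\<lambda>i. if i < l then F i else G (i - l)"
  let ?f = "\<lambda>v i. if i < l then fst v i else snd v (i - l)"
  note sc = scalar_direct_sum[OF is_pmodule_finite_direct_sum[OF F] is_pmodule_finite_direct_sum[OF G]]
  have "pmodule_hom P (direct_sum (finite_direct_sum l F) (finite_direct_sum l' G))
      (finite_direct_sum (l + l') ?H) (\<lambda>x. ?f)"
    by (auto simp: pmodule_hom_def linear_between_def sc fun_eq_iff)
  moreover have "bij_betw ?f (space_at (direct_sum (finite_direct_sum l F) (finite_direct_sum l' G)) x)
      (space_at (finite_direct_sum (l + l') ?H) x)" for x
  proof (rule bij_betw_byWitness[where
        f' = "\<lambda>h. (\<lambda>i. if i < l then h i else 0, \<lambda>i. if i < l' then h (i + l) else 0)"])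
    have "h i \<in> space_at (F i) x" if "i < l" "\<forall>i<l + l'. h i \<in> space_at (?H i) x" for h i
      using that(1) that(2)[rule_format, of i] by simp
    moreover have "h (i + l) \<in> space_at (G i) x"
      if "i < l'" "\<forall>i<l + l'. h i \<in> space_at (?H i) x" for h i
      using that(1) that(2)[rule_format, of "i + l"] by simp
    ultimately show "(\<lambda>h. (\<lambda>i. if i < l then h i else 0, \<lambda>i. if i < l' then h (i + l) else 0)) `
        space_at (finite_direct_sum (l + l') ?H) x \<subseteq>
        space_at (direct_sum (finite_direct_sum l F) (finite_direct_sum l' G)) x"
      by (intro image_subsetI) simp
  qed (auto simp: fun_eq_iff)
  ultimately show ?thesis unfolding pmodule_iso_def by blast
qed

lemma pmodule_iso_finite_direct_sum_1:
  assumes F: "\<And>i. is_pmodule P (F i)"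
  shows "pmodule_iso P (F 0) (finite_direct_sum 1 F)"
proof -
  have "pmodule_hom P (F 0) (finite_direct_sum 1 F) (\<lambda>x v i. if i = 0 then v else 0)"
    by (auto simp: pmodule_hom_def linear_between_def fun_eq_iff scalar_zero[OF F])
  moreover have "bij_betw (\<lambda>v i. if i = 0 then v else 0) (space_at (F 0) x)
      (space_at (finite_direct_sum 1 F) x)" for x
    by (rule bij_betw_byWitness[where f' = "\<lambda>f. f 0"]) (auto simp: fun_eq_iff)
  ultimately show ?thesis unfolding pmodule_iso_def by (intro exI conjI) auto
qed

lemma pmodule_iso_zero:
  assumes M: "is_pmodule P M" "is_zero P M" and N: "is_pmodule P N" "is_zero P N"
  shows "pmodule_iso P M N"
  unfolding pmodule_iso_def
  using pmodule_hom_zero[OF M(1) N(1)] M(2) N(2)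
  by (intro exI[of _ "\<lambda>x v. 0"]) (auto simp: is_zero_def bij_betw_def)

lemma pmodule_iso_direct_sum_zero:
  assumes "is_pmodule P Z" "is_zero P Z" and "is_pmodule P N"
  shows "pmodule_iso P N (direct_sum Z N)"
proof -
  have "pmodule_hom P N (direct_sum Z N) (\<lambda>x v. (0, v))"
    by (rule pmodule_hom_Pair[OF assms(1,3) pmodule_hom_zero[OF assms(3,1)] pmodule_hom_id])
  then show ?thesis
    unfolding pmodule_iso_def using assms(2)
    by (intro exI[of _ "\<lambda>x v. (0, v)"]) (auto simp: is_zero_def bij_betw_def inj_on_def)
qed

lemma is_zero_finite_direct_sum_0: "is_zero P (finite_direct_sum 0 F)"
  by (auto simp: is_zero_def finite_direct_sum_def)

section \<open>Total dimension and existence of decompositions into indecomposables\<close>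

definition total_dim :: "'x rel \<Rightarrow> ('k::field, 'x, 'v::ab_group_add) pmodule \<Rightarrow> nat" where
  "total_dim P M = (\<Sum>x\<in>Field P. vector_space.dim (scalar M) (space_at M x))"

lemma total_dim_iso:
  assumes "is_pmodule P M" and "is_pmodule P N" and "pmodule_iso P M N"
  shows "total_dim P N = total_dim P M"
proof -
  obtain f where f: "pmodule_hom P M N f"
    "\<And>x. x \<in> Field P \<Longrightarrow> bij_betw (f x) (space_at M x) (space_at N x)"
    using assms(3) by (rule pmodule_isoE) blast
  show ?thesis
    unfolding total_dim_def
    using dim_bij_betw[OF is_pmoduleD(2)[OF assms(1)] is_pmoduleD(1)[OF assms(2)]
        pmodule_homD(1)[OF f(1)] f(2)]
    by (intro sum.cong) auto
qed

lemma total_dim_direct_sum: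
  assumes "is_pmodule P M" and "is_pmodule P N"
  shows "total_dim P (direct_sum M N) = total_dim P M + total_dim P N"
  unfolding total_dim_def sum.distrib[symmetric]
  using fd_subspace_Times(2)[OF is_pmoduleD(2)[OF assms(1)] is_pmoduleD(2)[OF assms(2)]]
  by (intro sum.cong) (auto simp: direct_sum_def)

lemma total_dim_pos:
  assumes "finite (Field P)" and "is_pmodule P M" and "\<not> is_zero P M"
  shows "total_dim P M > 0"
proof -
  obtain x where x: "x \<in> Field P" "space_at M x \<noteq> {0}" using assms(3) by (auto simp: is_zero_def)
  then have "vector_space.dim (scalar M) (space_at M x) > 0"
    using dim_pos_fd is_pmoduleD(2)[OF assms(2)] by blast
  then show ?thesis unfolding total_dim_def using assms(1) x(1) by (intro sum_pos2) auto
qed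

text \<open>Induction on the total dimension, which is additive and, as \<open>Field P\<close> is
  finite, positive on nonzero modules. The summands provided by a failure of
  \<open>indecomposable\<close> have the ambient type of \<open>N\<close>, so the induction stays at
  one type.\<close>

lemma indec_decomposition_exists:
  fixes N :: "('k::field, 'x, 'v::ab_group_add) pmodule"
  assumes "finite (Field P)" and "is_pmodule P N"
  shows "\<exists>l F. indec_decomposition P N l F"
  using assms(2)
proof (induction "total_dim P N" arbitrary: N rule: less_induct)
  case less
  note N = less.prems
  consider "is_zero P N" | "indecomposable P N" | "\<not> is_zero P N" "\<not> indecomposable P N" by blast
  then show ?case
  proof cases
    case 1
    \<comment> \<open>The family must consist of modules at every index, also beyond the last
      summand; the constant family supplies them.\<close>
    then have "indec_decomposition P N 0 (\<lambda>_. N)"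
      using pmodule_iso_zero[OF N 1 is_pmodule_finite_direct_sum is_zero_finite_direct_sum_0] N
      by (simp add: indec_decomposition_def)
    then show ?thesis by blast
  next
    case 2
    then have "indec_decomposition P N 1 (\<lambda>_. N)"
      using pmodule_iso_finite_direct_sum_1[of P "\<lambda>_. N"] N by (simp add: indec_decomposition_def)
    then show ?thesis by blast
  next
    case 3
    then obtain A B :: "('k, 'x, 'v) pmodule" where A: "is_pmodule P A" "\<not> is_zero P A"
      and B: "is_pmodule P B" "\<not> is_zero P B" and iso: "pmodule_iso P N (direct_sum A B)"
      using N unfolding indecomposable_def by blast
    note AB = is_pmodule_direct_sum[OF A(1) B(1)]
    have "total_dim P N = total_dim P A + total_dim P B"
      using total_dim_iso[OF N AB iso] total_dim_direct_sum[OF A(1) B(1)] by simp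
    then have "total_dim P A < total_dim P N" "total_dim P B < total_dim P N"
      using total_dim_pos[OF assms(1) A] total_dim_pos[OF assms(1) B] by simp_all
    then obtain l F l' G where F: "indec_decomposition P A l F" and G: "indec_decomposition P B l' G"
      using less.hyps A(1) B(1) by metis
    let ?H = "\<lambda>i. if i < l then F i else G (i - l)"
    have F': "is_pmodule P (F i)" and G': "is_pmodule P (G i)" for i
      using F G by (auto simp: indec_decomposition_def)
    have "pmodule_iso P (direct_sum A B) (direct_sum (finite_direct_sum l F) (finite_direct_sum l' G))"
      using F G by (intro pmodule_iso_direct_sum A B is_pmodule_finite_direct_sum F' G')
        (auto simp: indec_decomposition_def)
    then have "pmodule_iso P N (finite_direct_sum (l + l') ?H)"
      by (rule pmodule_iso_trans[OF iso pmodule_iso_trans[OF _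
            pmodule_iso_finite_direct_sum_append[of P F G, OF F' G']]])
    moreover have "indecomposable P (?H i)" if "i < l + l'" for i
      using F G that by (auto simp: indec_decomposition_def)
    ultimately have "indec_decomposition P N (l + l') ?H"
      using F' G' by (simp add: indec_decomposition_def)
    then show ?thesis by blast
  qed
qed

lemma pmodule_iso_direct_sum_zero_right:
  assumes "is_pmodule P N" and "is_pmodule P Z" "is_zero P Z"
  shows "pmodule_iso P (direct_sum N Z) N"
proof -
  have "bij_betw fst (space_at (direct_sum N Z) x) (space_at N x)" if "x \<in> Field P" for x
    using assms(3) that by (auto simp: is_zero_def bij_betw_def inj_on_def)
  then show ?thesis
    unfolding pmodule_iso_def
    using pmodule_hom_fst[OF assms(1,2)] by (intro exI[of _ "\<lambda>x. fst"]) auto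
qed

section \<open>Multiplicity as the rank of a pairing\<close>

lemma vector_space_mult: "vector_space ((*) :: 'k::field \<Rightarrow> 'k \<Rightarrow> 'k)"
  by unfold_locales (simp_all add: algebra_simps)

text \<open>Covers both sides of the theorem: the bipath poset with \<open>I\<close>, and Z' with
  the preimage of \<open>I\<close>. Convexity makes the interval module functorial, and the least
  element generates it.\<close>

locale interval_with_min =
  fixes Q :: "'x rel" and J :: "'x set" and b :: 'x
  assumes preorder: "preorder_on (Field Q) Q"
    and finite_Field: "finite (Field Q)"
    and b_Field: "b \<in> Field Q" and b_J: "b \<in> J"
    and b_min: "\<And>x. x \<in> J \<Longrightarrow> x \<in> Field Q \<Longrightarrow> (b, x) \<in> Q"
    and convex: "\<And>x y z. x \<in> J \<Longrightarrow> z \<in> J \<Longrightarrow> (x, y) \<in> Q \<Longrightarrow> (y, z) \<in> Q \<Longrightarrow> y \<in> J"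
begin

lemma Q_trans: "(x, y) \<in> Q \<Longrightarrow> (y, z) \<in> Q \<Longrightarrow> (x, z) \<in> Q"
  using preorder by (auto simp: preorder_on_def dest: transD)

lemma interval_module_sel [simp]:
  "scalar (interval_module J) = (*)"
  "space_at (interval_module J) x = (if x \<in> J then UNIV else {0})"
  "action (interval_module J) x y c v = (if x \<in> J \<and> y \<in> J then c * v else 0)"
  by (simp_all add: interval_module_def)

lemma is_pmodule_interval_module: "is_pmodule Q (interval_module J :: ('k::field, 'x, 'k) pmodule)"
proof -
  have fin: "\<exists>B. finite B \<and> space_at (interval_module J :: ('k, 'x, 'k) pmodule) x = module.span (*) B" for x
  proof -
    interpret vector_space "(*) :: 'k \<Rightarrow> 'k \<Rightarrow> 'k" by (rule vector_space_mult)
    show ?thesis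
    proof (cases "x \<in> J")
      case True
      have "v \<in> span {1}" for v :: 'k by (auto simp: span_singleton)
      with True show ?thesis by (intro exI[of _ "{1}"]) auto
    next
      case False
      then show ?thesis by (intro exI[of _ "{}"]) auto
    qed
  qed
  \<comment> \<open>Functoriality could fail only along a path that leaves \<open>J\<close> and
    returns. By convexity the three elements then do not form a chain, so one of the two
    coefficients is 0.\<close>
  have comp: "d * c = 0"
    if "x \<in> J" "z \<in> J" "y \<notin> J" "c \<in> lin_hom Q x y" "d \<in> lin_hom Q y z" for x y z and c d :: 'k
    using that convex[of x z y] by (simp add: lin_hom_def split: if_splits)
  show ?thesis
    unfolding is_pmodule_def interval_module_sel(1)
  proof (intro conjI ballI allI)
    show "vector_space ((*) :: 'k \<Rightarrow> 'k \<Rightarrow> 'k)" by (rule vector_space_mult)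
    fix x y z and c d v :: 'k
    assume "c \<in> lin_hom Q x y" "d \<in> lin_hom Q y z"
      and "v \<in> space_at (interval_module J :: ('k, 'x, 'k) pmodule) x"
    then show "action (interval_module J) x z (d * c) v =
        action (interval_module J) y z d (action (interval_module J) x y c v)"
      using comp[of x z y c d] by (auto simp: mult.assoc)
  next
    fix x y and c :: 'k
    show "linear_between (*) (space_at (interval_module J) x) (*) (space_at (interval_module J) y)
        (action (interval_module J) x y c)"
      by (simp add: linear_between_def distrib_left mult.left_commute)
  qed (rule fin, auto simp: distrib_right mult.assoc)
qed

section \<open>Maps out of and into the interval module, seen at the least element\<close>

lemma interval_hom_at:
  fixes f :: "'x \<Rightarrow> 'k::field \<Rightarrow> 'v::ab_group_add"
  assumes "pmodule_hom Q (interval_module J) N f" and "x \<in> J" and "x \<in> Field Q"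
  shows "f x c = action N b x 1 (f b c)"
  using pmodule_homD(5)[OF assms(1) b_min[OF assms(2,3)], of c 1] b_J assms(2) by simp

text \<open>A map out of the interval module is determined by the image of 1 at \<open>b\<close>, so
  this is the Hom space realised inside the space at \<open>b\<close>.\<close>

definition reach :: "('k::field, 'x, 'v::ab_group_add) pmodule \<Rightarrow> 'v set" where
  "reach N = {f b 1 |f. pmodule_hom Q (interval_module J) N f}"

text \<open>The annihilator of all maps into the interval module. Dividing \<open>reach\<close> by
  its intersection with \<open>kill\<close> removes the radical of the pairing on that side, which
  is why the rank is a difference of two dimensions.\<close>

definition kill :: "('k::field, 'x, 'v::ab_group_add) pmodule \<Rightarrow> 'v set" where
  "kill N = {v \<in> space_at N b. \<forall>g. pmodule_hom Q N (interval_module J) g \<longrightarrow> g b v = 0}"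

text \<open>The rank of the composition pairing of \<open>Hom L N\<close> and \<open>Hom N L\<close> into \<open>End L = k\<close>, evaluated at
  \<open>b\<close>, where \<open>L\<close> is the interval module.\<close>

definition rk :: "('k::field, 'x, 'v::ab_group_add) pmodule \<Rightarrow> nat" where
  "rk N = vector_space.dim (scalar N) (reach N) - vector_space.dim (scalar N) (reach N \<inter> kill N)"

text \<open>The Yoneda lemma: the interval module is the projective generated at \<open>b\<close>
  modulo its part outside \<open>J\<close>. A vector at \<open>b\<close> is a map out of that
  projective, and it factors through the quotient iff the vector dies outside \<open>J\<close>. Only
  actions out of \<open>b\<close> occur here, and these can be compared before and after
  restriction.\<close>

lemma reach_eq:
  fixes N :: "('k::field, 'x, 'v::ab_group_add) pmodule"
  assumes N: "is_pmodule Q N"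
  shows "reach N = {v \<in> space_at N b. \<forall>y. (b, y) \<in> Q \<longrightarrow> y \<notin> J \<longrightarrow> action N b y 1 v = 0}"
proof (intro equalityI subsetI)
  fix v assume "v \<in> reach N"
  then obtain f where f: "pmodule_hom Q (interval_module J) N f" and v: "v = f b 1"
    by (auto simp: reach_def)
  have "action N b y 1 v = 0" if y: "(b, y) \<in> Q" "y \<notin> J" for y
  proof -
    have "y \<in> Field Q" using y by (auto simp: Field_def)
    then have "f y 0 = 0" by (rule pmodule_hom_0[OF is_pmodule_interval_module N f])
    then show ?thesis using pmodule_homD(5)[OF f y(1), of 1 1] y(2) b_J v by simp
  qed
  moreover have "v \<in> space_at N b" using pmodule_homD(2)[OF f b_Field, of 1] b_J v by simp
  ultimately show "v \<in> {v \<in> space_at N b. \<forall>y. (b, y) \<in> Q \<longrightarrow> y \<notin> J \<longrightarrow> action N b y 1 v = 0}"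
    by blast
next
  fix v assume "v \<in> {v \<in> space_at N b. \<forall>y. (b, y) \<in> Q \<longrightarrow> y \<notin> J \<longrightarrow> action N b y 1 v = 0}"
  then have v: "v \<in> space_at N b" and v0: "\<And>y. (b, y) \<in> Q \<Longrightarrow> y \<notin> J \<Longrightarrow> action N b y 1 v = 0"
    by auto
  interpret vector_space "scalar N" using N by (rule is_pmoduleD)
  have act: "action N b y c v = scalar N c (action N b y 1 v)" if "(b, y) \<in> Q" for y c
    using is_pmoduleD(6)[OF N that v, of c 1] by simp
  \<comment> \<open>Transport \<open>v\<close> from \<open>b\<close> to \<open>y\<close>; linearity
    of the action in its coefficient makes this linear in \<open>c\<close>.\<close>
  let ?f = "\<lambda>y c. if y \<in> J then action N b y c v else 0"
  have "pmodule_hom Q (interval_module J) N ?f"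
  proof (rule pmodule_homI[OF is_pmodule_interval_module N])
    show "linear_between (scalar (interval_module J)) (space_at (interval_module J) y)
        (scalar N) (space_at N y) (?f y)" if y: "y \<in> Field Q" for y
    proof (cases "y \<in> J")
      case True
      note bQ = b_min[OF True y]
      show ?thesis
        using True is_pmoduleD(4-6)[OF N bQ v] by (simp add: linear_between_def)
    next
      case False
      then show ?thesis using zero_in_space_at[OF N y] by (simp add: linear_between_def)
    qed
    fix y z and c :: 'k
    assume yz: "(y, z) \<in> Q" and c: "c \<in> space_at (interval_module J) y"
    have y: "y \<in> Field Q" and z: "z \<in> Field Q" using yz by (auto simp: Field_def)
    have zero: "action N y z 1 0 = 0"
      using linear_between_0[OF is_pmoduleD(2)[OF N y] vector_space_axioms is_pmoduleD(3)[OF N yz]] .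
    consider "y \<notin> J" | "y \<in> J" "z \<in> J" | "y \<in> J" "z \<notin> J" by blast
    then show "?f z (action (interval_module J) y z 1 c) = action N y z 1 (?f y c)"
    proof cases
      case 1
      then show ?thesis using zero act[of z 0] b_min[OF _ z] by simp
    next
      case 2
      then show ?thesis
        using is_pmoduleD(8)[OF N b_min[OF 2(1) y] yz b_min[OF 2(2) z] v, of 1 c] by simp
    next
      case 3
      \<comment> \<open>The path leaves \<open>J\<close>, and there \<open>v\<close> has
        died.\<close>
      have bz: "(b, z) \<in> Q" using b_min[OF 3(1) y] yz by (rule Q_trans)
      then show ?thesis
        using 3 is_pmoduleD(8)[OF N b_min[OF 3(1) y] yz bz v, of 1 c] act[OF bz, of c] v0[OF bz]
        by simp
    qed
  qed
  moreover have "?f b 1 = v" using b_J is_pmoduleD(7)[OF N b_Field v] by simp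
  ultimately show "v \<in> reach N" unfolding reach_def by (intro CollectI exI[of _ ?f]) simp
qed

lemma subspace_reach:
  assumes N: "is_pmodule Q N"
  shows "module.subspace (scalar N) (reach N)" and "reach N \<subseteq> space_at N b"
proof -
  interpret vector_space "scalar N" using N by (rule is_pmoduleD)
  note cl = fd_subspace_closed[OF is_pmoduleD(2)[OF N b_Field]]
  show "subspace (reach N)"
  proof (rule subspaceI)
    have "action N b y 1 0 = 0" if "(b, y) \<in> Q" for y
      using linear_between_0[OF is_pmoduleD(2)[OF N b_Field] vector_space_axioms
          is_pmoduleD(3)[OF N that]] .
    then show "0 \<in> reach N" using cl(1) by (simp add: reach_eq[OF N])
    show "u + v \<in> reach N" if "u \<in> reach N" "v \<in> reach N" for u v
      using that cl(2) is_pmoduleD(3)[OF N] unfolding reach_eq[OF N] linear_between_def by simp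
    show "scalar N a v \<in> reach N" if "v \<in> reach N" for a v
      using that cl(4) is_pmoduleD(3)[OF N] unfolding reach_eq[OF N] linear_between_def by simp
  qed
  show "reach N \<subseteq> space_at N b" by (auto simp: reach_eq[OF N])
qed

lemma subspace_kill:
  assumes N: "is_pmodule Q N"
  shows "module.subspace (scalar N) (kill N)" and "kill N \<subseteq> space_at N b"
proof -
  interpret vector_space "scalar N" using N by (rule is_pmoduleD)
  note cl = fd_subspace_closed[OF is_pmoduleD(2)[OF N b_Field]]
  show "subspace (kill N)"
  proof (rule subspaceI)
    show "0 \<in> kill N"
      using cl(1) pmodule_hom_0[OF N is_pmodule_interval_module _ b_Field] by (auto simp: kill_def)
    show "u + v \<in> kill N" if "u \<in> kill N" "v \<in> kill N" for u v
      using that cl(2) pmodule_homD(3)[OF _ b_Field] unfolding kill_def by fastforce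
    show "scalar N a v \<in> kill N" if "v \<in> kill N" for a v
      using that cl(4) pmodule_homD(4)[OF _ b_Field] unfolding kill_def by fastforce
  qed
  show "kill N \<subseteq> space_at N b" by (auto simp: kill_def)
qed

text \<open>Maps out of the interval module can be pushed forward along \<open>f\<close>. Dually,
  maps into it are pulled back in \<open>hom_kill\<close>. This functoriality carries both the
  invariance and the additivity of \<open>rk\<close>.\<close>

lemma hom_reach:
  assumes "pmodule_hom Q M N f" and "v \<in> reach M"
  shows "f b v \<in> reach N"
  using assms(2) pmodule_hom_comp[OF _ assms(1)] unfolding reach_def by fastforce

lemma hom_kill:
  assumes "pmodule_hom Q M N f" and "v \<in> kill M"
  shows "f b v \<in> kill N"
  using assms(2) pmodule_hom_comp[OF assms(1)] pmodule_homD(2)[OF assms(1) b_Field]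
  unfolding kill_def by fastforce

lemma hom_linear_between_subset:
  assumes "pmodule_hom Q M N f" and "S \<subseteq> space_at M b" and "f b ` S \<subseteq> T"
  shows "linear_between (scalar M) S (scalar N) T (f b)"
  using pmodule_homD(1)[OF assms(1) b_Field] assms(2,3) unfolding linear_between_def by blast

text \<open>An isomorphism and its inverse both preserve \<open>reach\<close> and
  \<open>kill\<close>, so the component at \<open>b\<close> restricts to bijections between these
  subspaces.\<close>

lemma rk_iso:
  assumes M: "is_pmodule Q M" and N: "is_pmodule Q N" and iso: "pmodule_iso Q M N"
  shows "rk N = rk M"
proof -
  obtain f where f: "pmodule_hom Q M N f"
    and bij: "\<And>x. x \<in> Field Q \<Longrightarrow> bij_betw (f x) (space_at M x) (space_at N x)"
    using iso by (rule pmodule_isoE) blast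
  define g where "g x = inv_into (space_at M x) (f x)" for x
  have g: "pmodule_hom Q N M g"
    unfolding g_def by (rule pmodule_iso_inv[OF M N f bij])
  have fg: "f b (g b w) = w" if "w \<in> space_at N b" for w
    using bij[OF b_Field] that by (simp add: g_def bij_betw_inv_into_right)
  have bij_sub: "bij_betw (f b) S T"
    if S: "S \<subseteq> space_at M b" and "T \<subseteq> space_at N b" "f b ` S \<subseteq> T" "g b ` T \<subseteq> S" for S T
    unfolding bij_betw_def
  proof
    show "inj_on (f b) S" using bij[OF b_Field] S by (auto simp: bij_betw_def intro: inj_on_subset)
    show "f b ` S = T"
    proof
      show "T \<subseteq> f b ` S"
      proof
        fix w assume "w \<in> T"
        then have "w = f b (g b w)" "g b w \<in> S" using fg that by auto
        then show "w \<in> f b ` S" by blast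
      qed
    qed (rule that)
  qed
  note rM = subspace_reach[OF M] and kM = subspace_kill[OF M]
  interpret vector_space "scalar M" using M by (rule is_pmoduleD)
  note fd = is_pmoduleD(2)[OF M b_Field]
  have dim: "vector_space.dim (scalar N) T = dim S"
    if S: "subspace S" "S \<subseteq> space_at M b" and T: "T \<subseteq> space_at N b" "f b ` S \<subseteq> T" "g b ` T \<subseteq> S" for S T
    using dim_bij_betw[OF fd_subspace_mono[OF fd S] is_pmoduleD(1)[OF N]
        hom_linear_between_subset[OF f S(2) T(2)] bij_sub[OF S(2) T]] .
  have "vector_space.dim (scalar N) (reach N) = dim (reach M)"
    using rM subspace_reach(2)[OF N] hom_reach[OF f] hom_reach[OF g] by (intro dim) auto
  moreover have "vector_space.dim (scalar N) (reach N \<inter> kill N) = dim (reach M \<inter> kill M)"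
    using rM kM subspace_reach(2)[OF N] hom_reach[OF f] hom_reach[OF g] hom_kill[OF f] hom_kill[OF g]
    by (intro dim subspace_inter) auto
  ultimately show ?thesis by (simp add: rk_def)
qed

text \<open>Functoriality under the two projections and the two inclusions makes
  \<open>reach\<close> and \<open>kill\<close> products, and dimensions add on products.\<close>

lemma rk_direct_sum:
  assumes M: "is_pmodule Q M" and N: "is_pmodule Q N"
  shows "rk (direct_sum M N) = rk M + rk N"
proof -
  note MN = is_pmodule_direct_sum[OF M N]
  interpret s: vector_space "scalar (direct_sum M N)" using MN by (rule is_pmoduleD)
  interpret M: vector_space "scalar M" using M by (rule is_pmoduleD)
  interpret N: vector_space "scalar N" using N by (rule is_pmoduleD)
  note p1 = pmodule_hom_fst[OF M N] and p2 = pmodule_hom_snd[OF M N]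
  note i1 = pmodule_hom_Pair[OF M N pmodule_hom_id pmodule_hom_zero[OF M N]]
  note i2 = pmodule_hom_Pair[OF M N pmodule_hom_zero[OF N M] pmodule_hom_id]
  have reach: "reach (direct_sum M N) = reach M \<times> reach N"
  proof (intro equalityI subsetI)
    fix v assume "v \<in> reach (direct_sum M N)"
    then show "v \<in> reach M \<times> reach N" using hom_reach[OF p1] hom_reach[OF p2] by (cases v) force
  next
    fix v assume v: "v \<in> reach M \<times> reach N"
    then have "(fst v, 0) + (0, snd v) \<in> reach (direct_sum M N)"
      using hom_reach[OF i1, of "fst v"] hom_reach[OF i2, of "snd v"]
      by (intro s.subspace_add[OF subspace_reach(1)[OF MN]]) auto
    then show "v \<in> reach (direct_sum M N)" by simp
  qed
  have kill: "kill (direct_sum M N) = kill M \<times> kill N"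
  proof (intro equalityI subsetI)
    fix v assume "v \<in> kill (direct_sum M N)"
    then show "v \<in> kill M \<times> kill N" using hom_kill[OF p1] hom_kill[OF p2] by (cases v) force
  next
    fix v assume v: "v \<in> kill M \<times> kill N"
    then have "(fst v, 0) + (0, snd v) \<in> kill (direct_sum M N)"
      using hom_kill[OF i1, of "fst v"] hom_kill[OF i2, of "snd v"]
      by (intro s.subspace_add[OF subspace_kill(1)[OF MN]]) auto
    then show "v \<in> kill (direct_sum M N)" by simp
  qed
  note fdM = fd_subspace_mono[OF is_pmoduleD(2)[OF M b_Field]]
  note fdN = fd_subspace_mono[OF is_pmoduleD(2)[OF N b_Field]]
  have rM: "fd_subspace (scalar M) (reach M)" "fd_subspace (scalar M) (reach M \<inter> kill M)"
    using subspace_reach[OF M] subspace_kill[OF M] by (auto intro!: fdM M.subspace_inter)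
  have rN: "fd_subspace (scalar N) (reach N)" "fd_subspace (scalar N) (reach N \<inter> kill N)"
    using subspace_reach[OF N] subspace_kill[OF N] by (auto intro!: fdN N.subspace_inter)
  \<comment> \<open>\<open>rk\<close> is a truncated difference of natural numbers; these
    inequalities ensure that no truncation occurs.\<close>
  have "M.dim (reach M \<inter> kill M) \<le> M.dim (reach M)" "N.dim (reach N \<inter> kill N) \<le> N.dim (reach N)"
    using dim_mono_fd(1)[OF rM(1) fd_subspaceD(2)[OF rM(2)]]
      dim_mono_fd(1)[OF rN(1) fd_subspaceD(2)[OF rN(2)]] by auto
  then show ?thesis
    using fd_subspace_Times(2)[OF rM(1) rN(1)] fd_subspace_Times(2)[OF rM(2) rN(2)]
    by (simp add: rk_def reach kill Times_Int_Times) (simp add: direct_sum_def)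
qed

text \<open>The identity already puts 1 into \<open>reach\<close> and leaves only 0 in
  \<open>kill\<close>.\<close>

lemma rk_interval_module: "rk (interval_module J :: ('k::field, 'x, 'k) pmodule) = 1"
proof -
  let ?L = "interval_module J :: ('k, 'x, 'k) pmodule"
  interpret vector_space "(*) :: 'k \<Rightarrow> 'k \<Rightarrow> 'k" by (rule vector_space_mult)
  have L: "is_pmodule Q ?L" by (rule is_pmodule_interval_module)
  have one: "1 \<in> reach ?L"
    unfolding reach_def using pmodule_hom_id[of Q ?L] by force
  have "v \<in> reach ?L" for v
    using subspace_scale[OF _ one, of v] subspace_reach(1)[OF L] by simp
  then have "reach ?L = UNIV" by blast
  moreover have "kill ?L = {0}"
    using subspace_0[of "kill ?L"] subspace_kill(1)[OF L]
      pmodule_hom_id[of Q ?L] by (auto simp: kill_def)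
  moreover have "dim (UNIV :: 'k set) = card {1 :: 'k}"
  proof (rule dim_eq_card)
    have "v \<in> span {1}" for v :: 'k by (auto simp: span_singleton)
    then show "span {1} = span (UNIV :: 'k set)" by auto
  qed simp
  moreover have "dim {0} = card ({} :: 'k set)"
    by (rule dim_eq_card) (auto simp: span_singleton independent_empty)
  ultimately show ?thesis by (simp add: rk_def)
qed

section \<open>From a nonzero pairing to a direct summand\<close>

lemma rk_pos_pair:
  assumes N: "is_pmodule Q N" and rk: "rk N \<noteq> 0"
  obtains f g where "pmodule_hom Q (interval_module J) N f"
    and "pmodule_hom Q N (interval_module J) g" and "g b (f b 1) \<noteq> 0"
proof -
  have "\<not> reach N \<subseteq> kill N" using rk by (auto simp: rk_def Int_absorb2)
  then obtain v where "v \<in> reach N" "v \<notin> kill N" by blast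
  moreover have "v \<in> space_at N b" using \<open>v \<in> reach N\<close> subspace_reach(2)[OF N] by blast
  ultimately show thesis using that unfolding reach_def kill_def by blast
qed

text \<open>The composite of \<open>f\<close> and \<open>g\<close> is an endomorphism of the
  interval module, hence multiplication by the nonzero scalar \<open>g b (f b 1)\<close>; up to this
  scalar \<open>f\<close> is a section of \<open>g\<close>. \<open>A\<close> is the image of
  \<open>f\<close>, a copy of the interval module with the ambient type of \<open>N\<close>, and
  \<open>B\<close> is the kernel of \<open>g\<close>.\<close>

lemma split_interval_module:
  fixes N :: "('k::field, 'x, 'v::ab_group_add) pmodule"
  assumes N: "is_pmodule Q N" and f: "pmodule_hom Q (interval_module J) N f"
    and g: "pmodule_hom Q N (interval_module J) g" and nz: "g b (f b 1) \<noteq> 0"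
  defines "A \<equiv> N\<lparr>space_at := \<lambda>x. f x ` space_at (interval_module J) x\<rparr>"
    and "B \<equiv> N\<lparr>space_at := \<lambda>x. {v \<in> space_at N x. g x v = 0}\<rparr>"
  shows "is_pmodule Q A" and "pmodule_iso Q (interval_module J) A" and "\<not> is_zero Q A"
    and "is_pmodule Q B" and "pmodule_iso Q N (direct_sum (interval_module J) B)"
proof -
  define L where "L = (interval_module J :: ('k, 'x, 'k) pmodule)"
  have L: "is_pmodule Q L" unfolding L_def by (rule is_pmodule_interval_module)
  note f = f[folded L_def] and g = g[folded L_def]
  define a where "a = g b (f b 1)"
  interpret vector_space "scalar N" using N by (rule is_pmoduleD)
  \<comment> \<open>On \<open>J\<close>, naturality from \<open>b\<close> to \<open>x\<close>
    reduces the claim to the component at \<open>b\<close>; off \<open>J\<close> the space is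
    zero.\<close>
  have gf: "g x (f x c) = a * c" if x: "x \<in> Field Q" and c: "c \<in> space_at L x" for x c
  proof (cases "x \<in> J")
    case True
    have "f b (scalar L c 1) = scalar N c (f b 1)"
      using b_J by (intro pmodule_homD(4)[OF f b_Field]) (simp add: L_def)
    moreover have fb: "f b u \<in> space_at N b" for u
      using pmodule_homD(2)[OF f b_Field] b_J by (simp add: L_def)
    ultimately have gfb: "g b (f b c) = c * a"
      using pmodule_homD(4)[OF g b_Field, of "f b 1" c] by (simp add: a_def L_def)
    have "f x c = action N b x 1 (f b c)"
      using interval_hom_at[OF f[unfolded L_def] True x] .
    then have "g x (f x c) = action L b x 1 (g b (f b c))"
      using pmodule_homD(5)[OF g b_min[OF True x] fb] by simp
    then show ?thesis using True b_J gfb by (simp add: L_def)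
  next
    case False
    then have "c = 0" using c by (simp add: L_def)
    then show ?thesis using pmodule_hom_0[OF L N f x] pmodule_hom_0[OF N L g x] by simp
  qed
  have fmem: "f x c \<in> space_at N x" if "x \<in> Field Q" "c \<in> space_at L x" for x c
    using pmodule_homD(2)[OF f that] .
  have gmem: "g x v \<in> space_at L x" if "x \<in> Field Q" "v \<in> space_at N x" for x v
    using pmodule_homD(2)[OF g that] .
  have a: "a \<noteq> 0" using nz by (simp add: a_def)
  note fd = is_pmoduleD(2)[OF N] and cl = fd_subspace_closed[OF is_pmoduleD(2)[OF N]]
  show A: "is_pmodule Q A"
    unfolding A_def L_def[symmetric]
  proof (rule is_pmodule_submodule[OF N])
    show "subspace (f x ` space_at L x)" if x: "x \<in> Field Q" for x
    proof -
      have "linear_between (scalar L) (space_at L x) (scalar N) (f x ` space_at L x) (f x)"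
        using pmodule_homD(1)[OF f x] by (auto simp: linear_between_def)
      then show ?thesis
        using fd_subspaceD(2)[OF fd_subspace_image(1)[OF is_pmoduleD(2)[OF L x] vector_space_axioms]]
        by blast
    qed
    show "f x ` space_at L x \<subseteq> space_at N x" if "x \<in> Field Q" for x using fmem[OF that] by blast
    show "action N x y 1 v \<in> f y ` space_at L y"
      if xy: "(x, y) \<in> Q" and "v \<in> f x ` space_at L x" for x y v
    proof -
      obtain c where c: "c \<in> space_at L x" "v = f x c" using \<open>v \<in> f x ` space_at L x\<close> by blast
      have "action N x y 1 v = f y (action L x y 1 c)" using pmodule_homD(5)[OF f xy c(1)] c by simp
      then show ?thesis using is_pmoduleD(4)[OF L xy c(1)] by blast
    qed
  qed
  have "pmodule_hom Q L A f"
    unfolding A_def L_def[symmetric] by (rule pmodule_hom_submodule[OF f]) blast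
  moreover have "bij_betw (f x) (space_at L x) (space_at A x)" if x: "x \<in> Field Q" for x
  proof -
    have "inj_on (f x) (space_at L x)"
    proof (rule inj_onI)
      fix c d assume "c \<in> space_at L x" "d \<in> space_at L x" "f x c = f x d"
      then have "a * c = a * d" using gf[OF x] by metis
      then show "c = d" using a by simp
    qed
    then show ?thesis by (simp add: bij_betw_def A_def L_def)
  qed
  ultimately show "pmodule_iso Q (interval_module J) A"
    unfolding pmodule_iso_def L_def by blast
  show "\<not> is_zero Q A"
  proof
    assume "is_zero Q A"
    then have "f b ` space_at L b = {0}" using b_Field by (simp add: is_zero_def A_def L_def)
    then have "f b 1 = 0" using b_J by (auto simp: L_def)
    then show False using nz pmodule_hom_0[OF N L g b_Field] by simp
  qed
  show B: "is_pmodule Q B"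
    unfolding B_def
  proof (rule is_pmodule_submodule[OF N])
    show "subspace {v \<in> space_at N x. g x v = 0}" if x: "x \<in> Field Q" for x
      using cl[OF x] pmodule_hom_0[OF N L g x] pmodule_homD(3,4)[OF g x]
      by (intro subspaceI) (auto simp: L_def)
    show "action N x y 1 v \<in> {v \<in> space_at N y. g y v = 0}"
      if xy: "(x, y) \<in> Q" and v: "v \<in> {v \<in> space_at N x. g x v = 0}" for x y v
      using is_pmoduleD(4)[OF N xy] pmodule_homD(5)[OF g xy, of v 1] v by (simp add: L_def)
  qed auto
  \<comment> \<open>The projection onto the kernel of \<open>g\<close> along the image of
    \<open>f\<close>; the factor \<open>inverse a\<close> turns \<open>f\<close> into an exact
    section of \<open>g\<close>.\<close>
  let ?h = "\<lambda>x v. v - scalar N (inverse a) (f x (g x v))"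
  have h: "pmodule_hom Q N N ?h"
    by (rule pmodule_hom_sub_scale[OF N N pmodule_hom_id pmodule_hom_comp[OF g f]])
  have gsc: "g x (scalar N c (f x u)) = c * (a * u)"
    if x: "x \<in> Field Q" and u: "u \<in> space_at L x" for x c u
    using pmodule_homD(4)[OF g x fmem[OF x u]] gf[OF x u] by (simp add: L_def)
  have "pmodule_hom Q N B ?h"
    unfolding B_def
  proof (rule pmodule_hom_submodule[OF h])
    fix x v assume x: "x \<in> Field Q" and v: "v \<in> space_at N x"
    have "g x (?h x v) = g x v - g x (scalar N (inverse a) (f x (g x v)))"
      using linear_between_diff[OF fd[OF x] is_pmoduleD(1)[OF L] pmodule_homD(1)[OF g x] v]
        cl(4)[OF x fmem[OF x gmem[OF x v]]] by blast
    also have "\<dots> = 0" using gsc[OF x gmem[OF x v], of "inverse a"] a by simp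
    finally show "?h x v \<in> {v \<in> space_at N x. g x v = 0}"
      using pmodule_homD(2)[OF h x v] by simp
  qed
  then have "pmodule_hom Q N (direct_sum L B) (\<lambda>x v. (g x v, ?h x v))"
    by (rule pmodule_hom_Pair[OF L B g])
  moreover have "bij_betw (\<lambda>v. (g x v, ?h x v)) (space_at N x) (space_at (direct_sum L B) x)"
    if x: "x \<in> Field Q" for x
  proof (rule bij_betw_byWitness[where f' = "\<lambda>w. scalar N (inverse a) (f x (fst w)) + snd w"])
    show "(\<lambda>v. (g x v, ?h x v)) ` space_at N x \<subseteq> space_at (direct_sum L B) x"
      using gmem[OF x] pmodule_homD(2)[OF \<open>pmodule_hom Q N B ?h\<close> x] by auto
    show "(\<lambda>w. scalar N (inverse a) (f x (fst w)) + snd w) ` space_at (direct_sum L B) x \<subseteq> space_at N x"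
      using cl(2,4)[OF x] fmem[OF x] by (auto simp: B_def)
    show "\<forall>v\<in>space_at N x. scalar N (inverse a) (f x (fst (g x v, ?h x v))) + snd (g x v, ?h x v) = v"
      by simp
    show "\<forall>w\<in>space_at (direct_sum L B) x.
        (g x (scalar N (inverse a) (f x (fst w)) + snd w),
         ?h x (scalar N (inverse a) (f x (fst w)) + snd w)) = w"
    proof
      fix w assume w: "w \<in> space_at (direct_sum L B) x"
      obtain c u where cu: "w = (c, u)" by (cases w)
      have c: "c \<in> space_at L x" and u: "u \<in> space_at N x" "g x u = 0"
        using w cu by (auto simp: B_def)
      have "g x (scalar N (inverse a) (f x c) + u) = c"
        using pmodule_homD(3)[OF g x cl(4)[OF x fmem[OF x c]] u(1)] gsc[OF x c, of "inverse a"] u(2) a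
        by simp
      then show "(g x (scalar N (inverse a) (f x (fst w)) + snd w),
         ?h x (scalar N (inverse a) (f x (fst w)) + snd w)) = w"
        by (simp add: cu)
    qed
  qed
  ultimately show "pmodule_iso Q N (direct_sum (interval_module J) B)"
    unfolding pmodule_iso_def L_def by blast
qed

lemma rk_zero:
  assumes "is_pmodule Q N" and "is_zero Q N"
  shows "rk N = 0"
proof -
  interpret vector_space "scalar N" using assms(1) by (rule is_pmoduleD)
  have "reach N \<subseteq> {0}"
    using subspace_reach(2)[OF assms(1)] assms(2) b_Field by (simp add: is_zero_def)
  moreover have "0 \<in> kill N" using subspace_kill(1)[OF assms(1)] by (rule subspace_0)
  ultimately have "reach N \<inter> kill N = reach N" by blast
  then show ?thesis by (simp add: rk_def)
qed

lemma rk_finite_direct_sum: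
  assumes F: "\<And>i. is_pmodule Q (F i)"
  shows "rk (finite_direct_sum l F) = (\<Sum>i<l. rk (F i))"
proof (induction l)
  case 0
  show ?case
    using rk_zero[OF is_pmodule_finite_direct_sum[of Q F 0, OF F] is_zero_finite_direct_sum_0] by simp
next
  case (Suc l)
  have fds: "is_pmodule Q (finite_direct_sum l F)" for l
    using F by (rule is_pmodule_finite_direct_sum)
  show ?case
    using rk_iso[OF is_pmodule_direct_sum[OF fds F] fds pmodule_iso_finite_direct_sum_Suc[of Q F l, OF F]]
      rk_direct_sum[OF fds F, of l l] Suc by simp
qed

section \<open>Summands and multiplicities read off from the rank\<close>

lemma has_summand_iff_rk:
  fixes N :: "('k::field, 'x, 'v::ab_group_add) pmodule"
  assumes N: "is_pmodule Q N"
  shows "has_summand Q N (interval_module J :: ('k, 'x, 'k) pmodule) \<longleftrightarrow> rk N \<noteq> 0"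
proof
  assume "has_summand Q N (interval_module J :: ('k, 'x, 'k) pmodule)"
  then obtain N' :: "('k, 'x, 'v) pmodule" where N': "is_pmodule Q N'"
    and iso: "pmodule_iso Q N (direct_sum (interval_module J) N')"
    by (auto simp: has_summand_def)
  note L = is_pmodule_interval_module
  show "rk N \<noteq> 0"
    using rk_iso[OF N is_pmodule_direct_sum[OF L N'] iso] rk_direct_sum[OF L N']
    by (simp add: rk_interval_module)
next
  assume "rk N \<noteq> 0"
  with N obtain f g where "pmodule_hom Q (interval_module J) N f"
    "pmodule_hom Q N (interval_module J) g" "g b (f b 1) \<noteq> 0"
    by (rule rk_pos_pair)
  from split_interval_module(4,5)[OF N this]
  show "has_summand Q N (interval_module J :: ('k, 'x, 'k) pmodule)"
    unfolding has_summand_def by blast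
qed

text \<open>Nonzero rank splits off a copy of the interval module, and indecomposability forces its
  complement to vanish.\<close>

lemma rk_indecomposable:
  fixes F :: "('k::field, 'x, 'v::ab_group_add) pmodule"
  assumes "indecomposable Q F"
  shows "rk F = (if pmodule_iso Q F (interval_module J :: ('k, 'x, 'k) pmodule) then 1 else 0)"
proof -
  have F: "is_pmodule Q F" using assms by (simp add: indecomposable_def)
  let ?L = "interval_module J :: ('k, 'x, 'k) pmodule"
  have L: "is_pmodule Q ?L" by (rule is_pmodule_interval_module)
  have "pmodule_iso Q F ?L" if nz: "rk F \<noteq> 0"
  proof -
    obtain f g where fg: "pmodule_hom Q ?L F f" "pmodule_hom Q F ?L g" "g b (f b 1) \<noteq> 0"
      using F nz by (rule rk_pos_pair)
    define A where "A = F\<lparr>space_at := \<lambda>x. f x ` space_at ?L x\<rparr>"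
    define B where "B = F\<lparr>space_at := \<lambda>x. {v \<in> space_at F x. g x v = 0}\<rparr>"
    note sp = split_interval_module[OF F fg, folded A_def B_def]
    have AL: "pmodule_iso Q A ?L" by (rule pmodule_iso_sym[OF L sp(1,2)])
    \<comment> \<open>\<open>indecomposable\<close> tests only summands with the ambient type of
      \<open>F\<close>, hence the passage from the interval module to its copy
      \<open>A\<close>.\<close>
    have "pmodule_iso Q F (direct_sum A B)"
      by (rule pmodule_iso_trans[OF sp(5) pmodule_iso_direct_sum[OF L sp(1,4,4,2) pmodule_iso_refl]])
    then have "is_zero Q B"
      using assms sp(1,3,4) unfolding indecomposable_def by blast
    then show ?thesis
      by (rule pmodule_iso_trans[OF sp(5) pmodule_iso_direct_sum_zero_right[OF L sp(4)]])
  qed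
  moreover have "rk F = 1" if "pmodule_iso Q F ?L"
    using rk_iso[OF F L that] by (simp add: rk_interval_module)
  ultimately show ?thesis by auto
qed

text \<open>By additivity the count equals the rank in every decomposition, which is the uniqueness
  that \<open>THE\<close> needs.\<close>

lemma mult_eq_rk:
  fixes N :: "('k::field, 'x, 'v::ab_group_add) pmodule"
  assumes N: "is_pmodule Q N"
  shows "mult Q N (interval_module J :: ('k, 'x, 'k) pmodule) = rk N"
proof -
  let ?L = "interval_module J :: ('k, 'x, 'k) pmodule"
  have count: "card {i. i < l \<and> pmodule_iso Q (F i) ?L} = rk N"
    if dec: "indec_decomposition Q N l F" for l F
  proof -
    have F: "is_pmodule Q (F i)" for i using dec by (simp add: indec_decomposition_def)
    have "rk N = rk (finite_direct_sum l F)"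
      using dec rk_iso[OF N is_pmodule_finite_direct_sum[of Q F l]] F
      by (simp add: indec_decomposition_def)
    also have "\<dots> = (\<Sum>i<l. rk (F i))" using F by (rule rk_finite_direct_sum)
    also have "\<dots> = (\<Sum>i<l. if pmodule_iso Q (F i) ?L then 1 else 0)"
      using dec by (intro sum.cong) (auto simp: indec_decomposition_def rk_indecomposable)
    also have "\<dots> = card ({..<l} \<inter> {i. pmodule_iso Q (F i) ?L})"
      by (simp add: sum.If_cases)
    also have "{..<l} \<inter> {i. pmodule_iso Q (F i) ?L} = {i. i < l \<and> pmodule_iso Q (F i) ?L}"
      by auto
    finally show ?thesis by simp
  qed
  obtain l F where "indec_decomposition Q N l F"
    using indec_decomposition_exists[OF finite_Field N] by blast
  then show ?thesis
    unfolding mult_def using count by (intro the_equality) metis+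
qed

text \<open>Copies are split off one at a time, each lowering the rank by 1, until a complement of
  rank 0 remains.\<close>

lemma power_sum_split_exists:
  fixes N :: "('k::field, 'x, 'v::ab_group_add) pmodule"
  assumes "is_pmodule Q N"
  shows "\<exists>N' :: ('k, 'x, 'v) pmodule. is_pmodule Q N' \<and> rk N' = 0 \<and>
    pmodule_iso Q N (direct_sum (power_sum (interval_module J :: ('k, 'x, 'k) pmodule) (rk N)) N')"
  using assms
proof (induction "rk N" arbitrary: N)
  case 0
  note N = "0.prems"
  let ?L = "interval_module J :: ('k, 'x, 'k) pmodule"
  have "pmodule_iso Q N (direct_sum (power_sum ?L 0) N)"
    unfolding power_sum_def
    by (rule pmodule_iso_direct_sum_zero[OF is_pmodule_finite_direct_sum is_zero_finite_direct_sum_0 N])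
      (rule is_pmodule_interval_module)
  then show ?case using 0 by metis
next
  case (Suc r)
  note N = Suc.prems
  let ?L = "interval_module J :: ('k, 'x, 'k) pmodule"
  have L: "is_pmodule Q ?L" by (rule is_pmodule_interval_module)
  have P: "is_pmodule Q (power_sum ?L r)" for r
    unfolding power_sum_def using L by (rule is_pmodule_finite_direct_sum)
  have "has_summand Q N ?L" using has_summand_iff_rk[OF N] Suc.hyps(2) by simp
  then obtain K :: "('k, 'x, 'v) pmodule" where K: "is_pmodule Q K"
    and NK: "pmodule_iso Q N (direct_sum ?L K)"
    by (auto simp: has_summand_def)
  have "rk N = Suc (rk K)"
    using rk_iso[OF N is_pmodule_direct_sum[OF L K] NK] rk_direct_sum[OF L K]
    by (simp add: rk_interval_module)
  then have r: "r = rk K" using Suc.hyps(2) by simp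
  obtain N' :: "('k, 'x, 'v) pmodule" where N': "is_pmodule Q N'" "rk N' = 0"
    and KN: "pmodule_iso Q K (direct_sum (power_sum ?L r) N')"
    using Suc.hyps(1)[OF r K] r by blast
  note PN = is_pmodule_direct_sum[OF P N'(1)]
  have "pmodule_iso Q (direct_sum ?L K) (direct_sum ?L (direct_sum (power_sum ?L r) N'))"
    by (rule pmodule_iso_direct_sum[OF L L K PN pmodule_iso_refl KN])
  note iso1 = this
  have "pmodule_iso Q (direct_sum ?L (direct_sum (power_sum ?L r) N'))
      (direct_sum (direct_sum (power_sum ?L r) ?L) N')"
    by (rule pmodule_iso_direct_sum_left_commute[OF L P N'(1)])
  note iso2 = this
  have "pmodule_iso Q (direct_sum (direct_sum (power_sum ?L r) ?L) N')
      (direct_sum (power_sum ?L (Suc r)) N')"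
    using pmodule_iso_finite_direct_sum_Suc[of Q "\<lambda>_. ?L" r] L
    by (intro pmodule_iso_direct_sum is_pmodule_direct_sum P L N' pmodule_iso_refl)
      (simp add: power_sum_def)
  then have "pmodule_iso Q N (direct_sum (power_sum ?L (Suc r)) N')"
    by (rule pmodule_iso_trans[OF NK pmodule_iso_trans[OF iso1 pmodule_iso_trans[OF iso2]]])
  then show ?case using N' Suc.hyps(2) by metis
qed

text \<open>Additivity gives \<open>rk N = r + rk N'\<close>, and a complement without the summand
  has rank 0, so \<open>r\<close> is forced.\<close>

lemma mult_bar_eq_rk:
  fixes N :: "('k::field, 'x, 'v::ab_group_add) pmodule"
  assumes N: "is_pmodule Q N"
  shows "mult_bar Q N (interval_module J :: ('k, 'x, 'k) pmodule) = rk N"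
proof -
  let ?L = "interval_module J :: ('k, 'x, 'k) pmodule"
  have P: "is_pmodule Q (power_sum ?L r)" and rkP: "rk (power_sum ?L r) = r" for r
    unfolding power_sum_def
    using is_pmodule_finite_direct_sum[OF is_pmodule_interval_module]
      rk_finite_direct_sum[OF is_pmodule_interval_module]
    by (simp_all add: rk_interval_module)
  have unique: "r = rk N"
    if N': "is_pmodule Q N'" and iso: "pmodule_iso Q N (direct_sum (power_sum ?L r) N')"
      and no: "\<not> has_summand Q N' ?L" for r and N' :: "('k, 'x, 'v) pmodule"
    using rk_iso[OF N is_pmodule_direct_sum[OF P N'] iso] rk_direct_sum[OF P N']
      no has_summand_iff_rk[OF N'] by (simp add: rkP)
  obtain N' :: "('k, 'x, 'v) pmodule" where "is_pmodule Q N'" "rk N' = 0"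
    "pmodule_iso Q N (direct_sum (power_sum ?L (rk N)) N')"
    using power_sum_split_exists[OF N] by blast
  then show ?thesis
    unfolding mult_bar_def using unique has_summand_iff_rk
    by (intro the_equality) blast+
qed

end

section \<open>The bipath poset and its cover\<close>

lemma is_pmodule_restriction:
  assumes h: "\<And>x y. (x, y) \<in> Q \<Longrightarrow> (h x, h y) \<in> P"
    and Q: "\<And>x. x \<in> Field Q \<Longrightarrow> (x, x) \<in> Q"
    and M: "is_pmodule P M"
  shows "is_pmodule Q (restriction h M)"
proof -
  \<comment> \<open>Reflexivity on \<open>Field Q\<close> turns order preservation into a map from
    \<open>Field Q\<close> to \<open>Field P\<close>.\<close>
  have F: "h x \<in> Field P" if "x \<in> Field Q" for x using h[OF Q[OF that]] by (auto simp: Field_def)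
  have hom: "c \<in> lin_hom P (h x) (h y)" if "c \<in> lin_hom Q x y" for c x y
    using that h[of x y] by (auto simp: lin_hom_def split: if_splits)
  note ax = is_pmodule_axioms[OF M]
  show ?thesis
    unfolding is_pmodule_def restriction_def pmodule.simps
    by (intro conjI ballI allI ax F hom)
qed

lemma pmodule_hom_restriction:
  assumes h: "\<And>x y. (x, y) \<in> Q \<Longrightarrow> (h x, h y) \<in> P"
    and Q: "\<And>x. x \<in> Field Q \<Longrightarrow> (x, x) \<in> Q"
    and f: "pmodule_hom P M N f"
  shows "pmodule_hom Q (restriction h M) (restriction h N) (\<lambda>x. f (h x))"
proof -
  have F: "h x \<in> Field P" if "x \<in> Field Q" for x using h[OF Q[OF that]] by (auto simp: Field_def)
  have hom: "c \<in> lin_hom P (h x) (h y)" if "c \<in> lin_hom Q x y" for c x y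
    using that h[of x y] by (auto simp: lin_hom_def split: if_splits)
  show ?thesis
    using f F hom unfolding pmodule_hom_def restriction_def pmodule.simps by blast
qed

text \<open>An equality and not only an isomorphism, so the results of
  \<open>interval_with_min\<close> apply to R'(V_I) as it stands.\<close>

lemma restriction_interval_module:
  "restriction h (interval_module I) = interval_module (h -` I)"
  by (simp add: restriction_def interval_module_def)

section \<open>Lifting relations of the bipath poset to Z'\<close>

lemma bipath_gen_lift:
  assumes "(x, y) \<in> (bipath_gen n m)\<^sup>*"
  shows "\<exists>w. (Pt x, w) \<in> (zprime_gen n m)\<^sup>* \<and> zeta w = y"
  using assms
proof induction
  case base
  then show ?case by (intro exI[of _ "Pt x"]) simp
next
  case (step y z)
  then obtain w where w: "(Pt x, w) \<in> (zprime_gen n m)\<^sup>*" "zeta w = y" by blast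
  \<comment> \<open>No generator starts at \<open>Top\<close>, so an intermediate point of the path
    has only one preimage under \<open>zeta\<close>.\<close>
  have "y \<noteq> Top" using step(2) by (auto simp: bipath_gen_def)
  then have "w = Pt y" using w(2) by (cases w) auto
  moreover have "\<exists>w'. (Pt y, w') \<in> zprime_gen n m \<and> zeta w' = z"
  \<comment> \<open>This is the one generator whose lift ends at \<open>Bar1\<close>; all others
    lift under \<open>Pt\<close>.\<close>
  proof (cases "y = Dn m \<and> z = Top")
    case True
    then show ?thesis by (intro exI[of _ Bar1]) (simp add: zprime_gen_def)
  next
    case False
    then show ?thesis using step(2)
      by (intro exI[of _ "Pt z"]) (auto simp: zprime_gen_def bipath_gen_def)
  qed
  ultimately show ?case using w(1) by (blast intro: rtrancl_into_rtrancl)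
qed

text \<open>Not every relation lifts under \<open>Pt\<close>: from \<open>Dn i\<close>, the path to
  \<open>Top\<close> ends at \<open>Bar1\<close>. A lift with a free endpoint over \<open>y\<close>
  is enough to compare \<open>reach\<close>, where only the elements above \<open>b\<close> and
  their actions matter.\<close>

lemma bipath_lift:
  assumes "(x, y) \<in> bipath n m"
  obtains w where "(Pt x, w) \<in> zprime n m" and "zeta w = y"
proof -
  obtain w where w: "(Pt x, w) \<in> (zprime_gen n m)\<^sup>*" "zeta w = y"
    using assms bipath_gen_lift[of x y n m] by (auto simp: bipath_def)
  have "w \<in> zprime_set n m"
    using assms w(2) by (cases w) (auto simp: bipath_def zprime_set_def)
  moreover have "Pt x \<in> zprime_set n m"
    using assms by (auto simp: bipath_def zprime_set_def)
  ultimately show thesis using w that by (simp add: zprime_def)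
qed

text \<open>\<open>Top\<close> is the only element with two preimages, so otherwise the endpoint of
  the lift is forced.\<close>

lemma zprime_PtI:
  assumes "(x, y) \<in> bipath n m" and "y \<noteq> Top"
  shows "(Pt x, Pt y) \<in> zprime n m"
proof -
  obtain w where w: "(Pt x, w) \<in> zprime n m" "zeta w = y" using assms(1) by (rule bipath_lift)
  then have "w = Pt y" using assms(2) by (cases w) auto
  then show ?thesis using w by simp
qed

section \<open>Order facts and extremal elements of the two posets\<close>

lemma bipath_refl: "x \<in> bipath_set n m \<Longrightarrow> (x, x) \<in> bipath n m"
  by (simp add: bipath_def)

lemma bipath_trans: "(x, y) \<in> bipath n m \<Longrightarrow> (y, z) \<in> bipath n m \<Longrightarrow> (x, z) \<in> bipath n m"
  by (auto simp: bipath_def)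

lemma zprime_refl: "z \<in> Field (zprime n m) \<Longrightarrow> (z, z) \<in> zprime n m"
  by (simp add: Field_zprime) (simp add: zprime_def)

lemma bipath_Top_only:
  assumes "(Top, x) \<in> bipath n m"
  shows "x = Top"
proof -
  have "(Top, x) \<in> (bipath_gen n m)\<^sup>*" using assms by (simp add: bipath_def)
  then show ?thesis by induction (auto simp: bipath_gen_def)
qed

lemma bipath_Bot_Up:
  assumes "1 \<le> i" and "i \<le> n"
  shows "(Bot, Up i) \<in> (bipath_gen n m)\<^sup>*"
  using assms
proof (induction i rule: dec_induct)
  case base
  show ?case by (auto simp: bipath_gen_def)
next
  case (step i)
  then have "(Up i, Up (Suc i)) \<in> bipath_gen n m" by (auto simp: bipath_gen_def)
  with step show ?case by (auto intro: rtrancl_into_rtrancl)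
qed

lemma bipath_Bot_Dn:
  assumes "1 \<le> i" and "i \<le> m"
  shows "(Bot, Dn i) \<in> (bipath_gen n m)\<^sup>*"
  using assms
proof (induction i rule: dec_induct)
  case base
  show ?case by (auto simp: bipath_gen_def)
next
  case (step i)
  then have "(Dn i, Dn (Suc i)) \<in> bipath_gen n m" by (auto simp: bipath_gen_def)
  with step show ?case by (auto intro: rtrancl_into_rtrancl)
qed

lemma bipath_Up_Top:
  assumes "i \<le> n" and "1 \<le> i"
  shows "(Up i, Top) \<in> (bipath_gen n m)\<^sup>*"
  using assms
proof (induction i rule: inc_induct)
  case base
  show ?case by (auto simp: bipath_gen_def)
next
  case (step i)
  then have "(Up i, Up (Suc i)) \<in> bipath_gen n m" by (auto simp: bipath_gen_def)
  with step show ?case by (auto intro: converse_rtrancl_into_rtrancl)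
qed

lemma bipath_Dn_Top:
  assumes "i \<le> m" and "1 \<le> i"
  shows "(Dn i, Top) \<in> (bipath_gen n m)\<^sup>*"
  using assms
proof (induction i rule: inc_induct)
  case base
  show ?case by (auto simp: bipath_gen_def)
next
  case (step i)
  then have "(Dn i, Dn (Suc i)) \<in> bipath_gen n m" by (auto simp: bipath_gen_def)
  with step show ?case by (auto intro: converse_rtrancl_into_rtrancl)
qed

lemma bipath_Bot_min:
  assumes "n \<ge> 1" and "x \<in> bipath_set n m"
  shows "(Bot, x) \<in> bipath n m"
proof -
  have "(Bot, Top) \<in> (bipath_gen n m)\<^sup>*"
    using bipath_Bot_Up[of n n m] bipath_Up_Top[of n n m] assms(1) by (auto intro: rtrancl_trans)
  with assms(2) show ?thesis
    using bipath_Bot_Up bipath_Bot_Dn by (auto simp: bipath_def bipath_set_def)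
qed

lemma bipath_Top_max:
  assumes "n \<ge> 1" and "x \<in> bipath_set n m"
  shows "(x, Top) \<in> bipath n m"
proof -
  have "(Bot, Top) \<in> bipath n m" using bipath_Bot_min[OF assms(1)] by (simp add: bipath_set_def)
  with assms(2) show ?thesis
    using bipath_Up_Top bipath_Dn_Top by (auto simp: bipath_def bipath_set_def)
qed

text \<open>The two elements over \<open>Top\<close> are reached along different branches:
  \<open>Pt Top\<close> through \<open>Up n\<close>, which uses \<open>n \<ge> 1\<close>, and
  \<open>Bar1\<close> through \<open>Dn m\<close>, which uses \<open>m \<ge> 1\<close>.\<close>

lemma zprime_Bot_min:
  assumes "n \<ge> 1" and "m \<ge> 1" and "z \<in> zprime_set n m"
  shows "(Pt Bot, z) \<in> zprime n m"
proof -
  have lift: "(Pt Bot, Pt x) \<in> (zprime_gen n m)\<^sup>*" if "x \<in> bipath_set n m" "x \<noteq> Top" for x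
    using zprime_PtI[OF bipath_Bot_min[OF assms(1) that(1)] that(2)] by (simp add: zprime_def)
  have "(Pt Bot, Pt Top) \<in> (zprime_gen n m)\<^sup>*"
    using lift[of "Up n"] assms(1)
    by (auto simp: bipath_set_def zprime_gen_def intro: rtrancl_into_rtrancl)
  moreover have "(Pt Bot, Bar1) \<in> (zprime_gen n m)\<^sup>*"
    using lift[of "Dn m"] assms(2)
    by (auto simp: bipath_set_def zprime_gen_def intro: rtrancl_into_rtrancl)
  ultimately have "(Pt Bot, z) \<in> (zprime_gen n m)\<^sup>*"
    using assms(3) lift by (auto simp: zprime_set_def)
  then show ?thesis using assms(3) by (auto simp: zprime_def zprime_set_def bipath_set_def)
qed

text \<open>The first three families consist of unions of two segments with a common bottom and tops
  other than \<open>Top\<close>; the common bottom makes such a union convex. The final clause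
  prepares the case distinction for maps into the interval module: \<open>Top\<close> lies in the
  interval only if this is the whole poset.\<close>

lemma interval_with_least_element:
  assumes n: "n \<ge> 1"
    and I: "I \<in> intervals_down n m \<union> intervals_up n m \<union> intervals_left n m \<union> {bipath_set n m}"
  obtains b where "b \<in> I" and "I \<subseteq> bipath_set n m" and "\<And>x. x \<in> I \<Longrightarrow> (b, x) \<in> bipath n m"
    and "\<And>x y z. x \<in> I \<Longrightarrow> z \<in> I \<Longrightarrow> (x, y) \<in> bipath n m \<Longrightarrow> (y, z) \<in> bipath n m \<Longrightarrow> y \<in> I"
    and "Top \<notin> I \<or> I = bipath_set n m \<and> b = Bot"
proof -
  have mem: "x \<in> bipath_set n m" "y \<in> bipath_set n m" if "(x, y) \<in> bipath n m" for x y
    using that by (auto simp: bipath_def)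
  have up: "Up i \<in> bipath_set n m \<longleftrightarrow> 1 \<le> i \<and> i \<le> n" for i by (auto simp: bipath_set_def)
  have dn: "Dn i \<in> bipath_set n m \<longleftrightarrow> 1 \<le> i \<and> i \<le> m" for i by (auto simp: bipath_set_def)
  have Bot: "Bot \<in> bipath_set n m" by (simp add: bipath_set_def)
  note witness = that
  \<comment> \<open>A single segment is the case \<open>t = t'\<close>.\<close>
  have seg: thesis
    if I: "I = segment (bipath n m) s t \<union> segment (bipath n m) s t'"
      and st: "(s, t) \<in> bipath n m" and "t \<noteq> Top" "t' \<noteq> Top" for s t t'
  proof (rule witness[of s])
    show "s \<in> I" using st bipath_refl mem(1) by (auto simp: segment_def I)
    show "I \<subseteq> bipath_set n m" using mem by (auto simp: segment_def I)
    show "(s, x) \<in> bipath n m" if "x \<in> I" for x using that by (auto simp: segment_def I)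
    show "y \<in> I" if "x \<in> I" "z \<in> I" "(x, y) \<in> bipath n m" "(y, z) \<in> bipath n m" for x y z
      using that bipath_trans unfolding segment_def I by blast
    have "Top \<notin> I"
      using bipath_Top_only \<open>t \<noteq> Top\<close> \<open>t' \<noteq> Top\<close> unfolding segment_def I by blast
    then show "Top \<notin> I \<or> I = bipath_set n m \<and> s = Bot" ..
  qed
  have Up_le: "(Up s, Up t) \<in> bipath n m" if "1 \<le> s" "s \<le> t" "t \<le> n" for s t
  proof -
    have "(Up s, Up t) \<in> (bipath_gen n m)\<^sup>*"
      using that(2,3,1)
    proof (induction t rule: dec_induct)
      case (step i)
      then have "(Up i, Up (Suc i)) \<in> bipath_gen n m" by (auto simp: bipath_gen_def)
      with step show ?case by (auto intro: rtrancl_into_rtrancl)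
    qed simp
    then show ?thesis using that up by (simp add: bipath_def)
  qed
  have Dn_le: "(Dn s, Dn t) \<in> bipath n m" if "1 \<le> s" "s \<le> t" "t \<le> m" for s t
  proof -
    have "(Dn s, Dn t) \<in> (bipath_gen n m)\<^sup>*"
      using that(2,3,1)
    proof (induction t rule: dec_induct)
      case (step i)
      then have "(Dn i, Dn (Suc i)) \<in> bipath_gen n m" by (auto simp: bipath_gen_def)
      with step show ?case by (auto intro: rtrancl_into_rtrancl)
    qed simp
    then show ?thesis using that dn by (simp add: bipath_def)
  qed
  consider "I \<in> intervals_down n m" | "I \<in> intervals_up n m" | "I \<in> intervals_left n m"
    | "I = bipath_set n m" using I by blast
  then show thesis
  proof cases
    case 1
    then obtain s t where "I = segment (bipath n m) (Dn s) (Dn t)" "1 \<le> s" "s \<le> t" "t \<le> m"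
      by (auto simp: intervals_down_def)
    then show thesis using seg[of "Dn s" "Dn t" "Dn t"] Dn_le by simp
  next
    case 2
    then obtain s t where "I = segment (bipath n m) (Up s) (Up t)" "1 \<le> s" "s \<le> t" "t \<le> n"
      by (auto simp: intervals_up_def)
    then show thesis using seg[of "Up s" "Up t" "Up t"] Up_le by simp
  next
    case 3
    then obtain t t' where "I = segment (bipath n m) Bot t \<union> segment (bipath n m) Bot t'"
      and "t \<in> {Bot} \<union> Up ` {1..n}" "t' \<in> {Bot} \<union> Dn ` {1..m}"
      by (auto simp: intervals_left_def)
    moreover from this have "(Bot, t) \<in> bipath n m" "t \<noteq> Top" "t' \<noteq> Top"
      using bipath_Bot_min[OF n, of t m] by (auto simp: bipath_set_def)
    ultimately show thesis using seg[of Bot t t'] by simp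
  next
    case 4
    then show thesis using that[of Bot] Bot bipath_Bot_min[OF n] mem by blast
  qed
qed

theorem proposition6p9:
  fixes n m :: nat
    and I :: "bipath_elem set"
    and M :: "('k::field, bipath_elem, 'v::ab_group_add) pmodule"
  assumes "n \<ge> 1" and "m \<ge> 1"
    and "I \<in> intervals_down n m \<union> intervals_up n m \<union> intervals_left n m \<union> {bipath_set n m}"
    and "is_pmodule (bipath n m) M"
  shows "mult (bipath n m) M (interval_module I :: ('k, bipath_elem, 'k) pmodule) =
      mult_bar (zprime n m) (restriction zeta M)
        (restriction zeta (interval_module I :: ('k, bipath_elem, 'k) pmodule)) \<and>
    mult_bar (zprime n m) (restriction zeta M)
        (restriction zeta (interval_module I :: ('k, bipath_elem, 'k) pmodule)) =
      mult (zprime n m) (restriction zeta M)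
        (restriction zeta (interval_module I :: ('k, bipath_elem, 'k) pmodule))"
proof -
  let ?P = "bipath n m" and ?Z = "zprime n m" and ?R = "restriction zeta M"
  obtain b where b: "b \<in> I" and sub: "I \<subseteq> bipath_set n m" and min: "\<And>x. x \<in> I \<Longrightarrow> (b, x) \<in> ?P"
    and conv: "\<And>x y z. x \<in> I \<Longrightarrow> z \<in> I \<Longrightarrow> (x, y) \<in> ?P \<Longrightarrow> (y, z) \<in> ?P \<Longrightarrow> y \<in> I"
    and Top: "Top \<notin> I \<or> I = bipath_set n m \<and> b = Bot"
    by (rule interval_with_least_element[OF assms(1,3)]) blast
  have fin: "finite (bipath_set n m)" by (simp add: bipath_set_def)
  have FZ: "Pt x \<in> Field ?Z" if "x \<in> Field ?P" for x
    using that by (simp add: Field_bipath Field_zprime zprime_set_def)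
  interpret P: interval_with_min ?P I b
  proof
    show "preorder_on (Field ?P) ?P"
      using partial_order_bipath[of n m] by (simp add: Field_bipath partial_order_on_def)
    show "finite (Field ?P)" "b \<in> Field ?P" using fin b sub by (auto simp: Field_bipath)
    show "(b, x) \<in> ?P" if "x \<in> I" for x using that by (rule min)
    show "y \<in> I" if "x \<in> I" "z \<in> I" "(x, y) \<in> ?P" "(y, z) \<in> ?P" for x y z
      using that by (rule conv)
  qed (rule b)
  interpret Z: interval_with_min ?Z "zeta -` I" "Pt b"
  proof
    show "preorder_on (Field ?Z) ?Z"
      using partial_order_zprime[of n m] by (simp add: Field_zprime partial_order_on_def)
    show "finite (Field ?Z)" using fin by (simp add: Field_zprime zprime_set_def)
    show "Pt b \<in> Field ?Z" using FZ P.b_Field by blast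
    show "Pt b \<in> zeta -` I" using b by simp
    \<comment> \<open>If \<open>z\<close> lies over \<open>Top\<close>, then \<open>b\<close> is
      \<open>Bot\<close>, which is below both \<open>Pt Top\<close> and \<open>Bar1\<close>;
      otherwise the relation lifts under \<open>Pt\<close>.\<close>
    show "(Pt b, z) \<in> ?Z" if "z \<in> zeta -` I" "z \<in> Field ?Z" for z
    proof (cases "zeta z = Top")
      case True
      then have "b = Bot" using that(1) Top by auto
      then show ?thesis using zprime_Bot_min[OF assms(1,2)] that(2) by (simp add: Field_zprime)
    next
      case False
      then have "z = Pt (zeta z)" by (cases z) auto
      then show ?thesis using zprime_PtI[OF min False] that(1) by auto
    qed
    show "y \<in> zeta -` I" if "x \<in> zeta -` I" "z \<in> zeta -` I" "(x, y) \<in> ?Z" "(y, z) \<in> ?Z" for x y z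
      using conv[of "zeta x" "zeta z" "zeta y"] zeta_mono that by auto
  qed
  note M = assms(4)
  have R: "is_pmodule ?Z ?R" by (rule is_pmodule_restriction[OF zeta_mono zprime_refl M])
  have R_sel: "scalar ?R = scalar M" "space_at ?R z = space_at M (zeta z)"
    "action ?R z w = action M (zeta z) (zeta w)" for z w
    by (simp_all add: restriction_def)
  let ?V = "interval_module I :: ('k, bipath_elem, 'k) pmodule"
  let ?W = "interval_module (zeta -` I) :: ('k, zprime_elem, 'k) pmodule"
  note V = P.is_pmodule_interval_module[where 'k = 'k]
  \<comment> \<open>Restriction keeps the ambient space and \<open>Pt b\<close> lies over
    \<open>b\<close>, so both sides are subsets of the same vector space. By
    \<open>bipath_lift\<close> they are cut out by the same vanishing conditions.\<close>
  have reach: "Z.reach ?R = P.reach M"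
  proof -
    have "(\<forall>w. (Pt b, w) \<in> ?Z \<longrightarrow> zeta w \<notin> I \<longrightarrow> action M b (zeta w) 1 v = 0) \<longleftrightarrow>
        (\<forall>y. (b, y) \<in> ?P \<longrightarrow> y \<notin> I \<longrightarrow> action M b y 1 v = 0)" for v
      using zeta_mono[of "Pt b"] by (auto elim: bipath_lift)
    then show ?thesis by (simp add: Z.reach_eq[OF R] P.reach_eq[OF M] R_sel)
  qed
  \<comment> \<open>\<open>kill\<close> sees only the component at \<open>b\<close>, so agreement
    there suffices; \<open>g\<close> itself need not come from a map over the bipath poset.\<close>
  have ext: "\<exists>g'. pmodule_hom ?P M ?V g' \<and> (\<forall>v\<in>space_at M b. g' b v = g (Pt b) v)"
    if g: "pmodule_hom ?Z ?R ?W g" for g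
    using Top
  proof
    assume Top: "Top \<notin> I"
    \<comment> \<open>The target is zero at \<open>Top\<close>, which settles naturality into
      \<open>Top\<close>, the only endpoint at which a relation may fail to lift under
      \<open>Pt\<close>.\<close>
    have gTop: "g (Pt Top) v = 0" if "v \<in> space_at M Top" for v
      using pmodule_homD(2)[OF g, of "Pt Top" v] that Top
      by (simp add: R_sel Field_zprime zprime_set_def bipath_set_def)
    have "pmodule_hom ?P M ?V (\<lambda>x. g (Pt x))"
    proof (rule pmodule_homI[OF M V])
      show "linear_between (scalar M) (space_at M x) (scalar ?V) (space_at ?V x) (g (Pt x))"
        if "x \<in> Field ?P" for x
        using pmodule_homD(1)[OF g FZ[OF that]] by (simp add: R_sel)
      fix x y v assume xy: "(x, y) \<in> ?P" and v: "v \<in> space_at M x"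
      show "g (Pt y) (action M x y 1 v) = action ?V x y 1 (g (Pt x) v)"
      proof (cases "y = Top")
        case True
        then show ?thesis using gTop is_pmoduleD(4)[OF M xy v] Top by simp
      next
        case False
        then show ?thesis
          using pmodule_homD(5)[OF g zprime_PtI[OF xy False], of v 1] v by (simp add: R_sel)
      qed
    qed
    then show ?thesis by blast
  next
    txt \<open>Extending along \<open>M x \<rightarrow> M Top\<close> may change the component of \<open>g\<close> at \<open>Dn i\<close>, but not at \<open>Bot\<close>.\<close>
    assume full: "I = bipath_set n m \<and> b = Bot"
    have TopF: "Pt Top \<in> Field ?Z" by (simp add: Field_zprime zprime_set_def bipath_set_def)
    have max: "(x, Top) \<in> ?P" if "x \<in> Field ?P" for x
      using bipath_Top_max[OF assms(1)] that by (simp add: Field_bipath)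
    have inI: "x \<in> I" if "x \<in> Field ?P" for x using that full by (simp add: Field_bipath)
    have TI: "Top \<in> I" using full by (simp add: bipath_set_def)
    let ?g = "\<lambda>x v. g (Pt Top) (action M x Top 1 v)"
    have "pmodule_hom ?P M ?V ?g"
    proof (rule pmodule_homI[OF M V])
      show "linear_between (scalar M) (space_at M x) (scalar ?V) (space_at ?V x) (?g x)"
        if x: "x \<in> Field ?P" for x
        using linear_between_comp[OF is_pmoduleD(3)[OF M max[OF x], of 1], of _ _ "g (Pt Top)"]
          pmodule_homD(1)[OF g TopF] inI[OF x] TI by (simp add: R_sel)
      fix x y v assume xy: "(x, y) \<in> ?P" and v: "v \<in> space_at M x"
      then have "x \<in> Field ?P" "y \<in> Field ?P" by (auto simp: Field_def)
      then show "?g y (action M x y 1 v) = action ?V x y 1 (?g x v)"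
        using is_pmoduleD(8)[OF M xy max max v, of 1 1] inI by simp
    qed
    moreover have "?g b v = g (Pt b) v" if v: "v \<in> space_at M b" for v
    proof -
      \<comment> \<open>\<open>Bot\<close> is below \<open>Pt Top\<close> in Z', and the interval
        module of the whole poset acts by the identity between them, so naturality of
        \<open>g\<close> gives the equality.\<close>
      have "(Pt b, Pt Top) \<in> ?Z"
        using zprime_Bot_min[OF assms(1,2)] TopF full by (simp add: Field_zprime)
      from pmodule_homD(5)[OF g this, of v 1] show ?thesis
        using v TI b by (simp add: R_sel)
    qed
    ultimately show ?thesis by blast
  qed
  have kill: "Z.kill ?R = P.kill M"
  proof (intro equalityI subsetI)
    fix v assume v: "v \<in> Z.kill ?R"
    \<comment> \<open>A map over the bipath poset restricts to one over Z' with the same component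
      at \<open>b\<close>; the converse inclusion rests on \<open>ext\<close>.\<close>
    have "g b v = 0" if "pmodule_hom ?P M ?V g" for g
      using v pmodule_hom_restriction[OF zeta_mono zprime_refl that]
      by (fastforce simp: Z.kill_def restriction_interval_module)
    then show "v \<in> P.kill M" using v by (simp add: P.kill_def Z.kill_def R_sel)
  next
    fix v assume v: "v \<in> P.kill M"
    have "g (Pt b) v = 0" if g: "pmodule_hom ?Z ?R ?W g" for g
    proof -
      obtain g' where "pmodule_hom ?P M ?V g'" "\<forall>v\<in>space_at M b. g' b v = g (Pt b) v"
        using ext[OF g] by blast
      then show ?thesis using v unfolding P.kill_def by fastforce
    qed
    then show "v \<in> Z.kill ?R" using v by (simp add: P.kill_def Z.kill_def R_sel)
  qed
  have "Z.rk ?R = P.rk M" by (simp add: Z.rk_def P.rk_def reach kill R_sel)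
  then show ?thesis
    by (simp add: restriction_interval_module P.mult_eq_rk[OF M] Z.mult_eq_rk[OF R]
        Z.mult_bar_eq_rk[OF R])
qed

end
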